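(* Let $\pi\in\mathfrak S_n$ avoid the pattern $231$, and let $m\in[n]$ be such that $\pi_m=n$. Then $\pi=12[\pi',21[1,\pi'']]$ for $231$-avoiding permutations $\pi'$ and $\pi''$ with $|\pi'|=m-1$ and $|\pi''|=n-m$. Moreover, (i) $\operatorname{diam}(G_{\pi})=\operatorname{diam}(G_{\pi'})+\operatorname{diam}(G_{\pi''})+(n-m)(\ell(\pi')+\ell(\pi''))+\ell(\pi'')(\ell(\pi')-1)$; (ii) $\operatorname{diam}(C_{\pi})=\operatorname{diam}(C_{\pi'})+\operatorname{diam}(C_{\pi''})+\ell(\pi'')$; (iii) $\operatorname{diam}(B_{\pi})=\operatorname{diam}(B_{\pi'})+\operatorname{diam}(B_{\pi''})+(n-m)(\ell(\pi')+\ell(\pi''))+\ell(\pi'')(\ell(\pi')-2)$.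
   Context: A permutation $\pi$ contains a pattern $\sigma$ if some subsequence of its one-line notation is order isomorphic to $\sigma$, and avoids $\sigma$ otherwise. $|\pi|$ is the size of $\pi$ (size $0$ allowed). For $\alpha\in\mathfrak S_a$, $\beta\in\mathfrak S_b$: $12[\alpha,\beta]=\alpha_1\cdots\alpha_a(\beta_1+a)\cdots(\beta_b+a)$ and $21[\alpha,\beta]=(\alpha_1+b)\cdots(\alpha_a+b)\beta_1\cdots\beta_b$. For $\pi\in\mathfrak S_n$, $\ell(\pi)$ is the number of inversions, and $R(\pi)$ is the set of reduced words: words $r_1\cdots r_{\ell(\pi)}$ in $[n-1]$ with $\pi=s_{r_1}\cdots s_{r_{\ell(\pi)}}$, $s_i=(i,i+1)$. A commutation move exchanges adjacent letters $jk$ with $|j-k|>1$; a long braid move replaces consecutive $j(j+1)j$ by $(j+1)j(j+1)$ or vice versa. $G_\pi$ is the graph on $R(\pi)$ with edges given by single commutation or long braid moves; $C_\pi$ is $G_\pi$ with commutation edges contracted; $B_\pi$ is $G_\pi$ with long braid edges contracted. Diameter = maximum distance between two vertices (one-vertex graph: $0$). *)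

theory Defs
  imports
    "HOL-Library.Sublist"
    "HOL-Combinatorics.Combinatorics"
    "Graph_Theory.Graph_Theory"
begin

text \<open>
  A permutation of size \<open>n\<close> is given by its one-line notation, an element of
  \<^term>\<open>permutations_of_set {1..n::nat}\<close>; its size is the length of the list.
  The entry written \<open>\<pi>\<close> with subscript \<open>i\<close>, for \<open>i\<close> from \<open>1\<close> to \<open>n\<close>, is \<open>\<pi> ! (i - 1)\<close>.
\<close>

definition order_isomorphic :: "nat list \<Rightarrow> nat list \<Rightarrow> bool" where
  "order_isomorphic xs ys \<longleftrightarrow> length xs = length ys \<and>
     (\<forall>i<length xs. \<forall>j<length xs. xs ! i < xs ! j \<longleftrightarrow> ys ! i < ys ! j)"

definition contains_pattern :: "nat list \<Rightarrow> nat list \<Rightarrow> bool" where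
  "contains_pattern \<pi> \<sigma> \<longleftrightarrow> (\<exists>xs. subseq xs \<pi> \<and> order_isomorphic xs \<sigma>)"

definition avoids :: "nat list \<Rightarrow> nat list \<Rightarrow> bool" where
  "avoids \<pi> \<sigma> \<longleftrightarrow> \<not> contains_pattern \<pi> \<sigma>"

definition inflate12 :: "nat list \<Rightarrow> nat list \<Rightarrow> nat list" where
  "inflate12 \<alpha> \<beta> = \<alpha> @ map (\<lambda>b. b + length \<alpha>) \<beta>"

definition inflate21 :: "nat list \<Rightarrow> nat list \<Rightarrow> nat list" where
  "inflate21 \<alpha> \<beta> = map (\<lambda>a. a + length \<beta>) \<alpha> @ \<beta>"

definition inv_count :: "nat list \<Rightarrow> nat" where
  "inv_count \<pi> = card {(i, j). i < j \<and> j < length \<pi> \<and> \<pi> ! j < \<pi> ! i}"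

definition simple_transp :: "nat \<Rightarrow> nat \<Rightarrow> nat" where
  "simple_transp i = Transposition.transpose i (i + 1)"

text \<open>Products of permutations are composed from right to left.\<close>

definition word_prod :: "nat list \<Rightarrow> nat \<Rightarrow> nat" where
  "word_prod w = foldr (\<lambda>r f. simple_transp r \<circ> f) w id"

definition reduced_words :: "nat list \<Rightarrow> nat list set" where
  "reduced_words \<pi> = {w. set w \<subseteq> {1..length \<pi> - 1} \<and> length w = inv_count \<pi> \<and>
     map (word_prod w) [1..<length \<pi> + 1] = \<pi>}"

definition commutation_move :: "nat list \<Rightarrow> nat list \<Rightarrow> bool" where
  "commutation_move u v \<longleftrightarrow> (\<exists>x y j k. (j + 1 < k \<or> k + 1 < j) \<and>
     u = x @ [j, k] @ y \<and> v = x @ [k, j] @ y)"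

definition long_braid_move :: "nat list \<Rightarrow> nat list \<Rightarrow> bool" where
  "long_braid_move u v \<longleftrightarrow> (\<exists>x y j.
     u = x @ [j, j + 1, j] @ y \<and> v = x @ [j + 1, j, j + 1] @ y \<or>
     u = x @ [j + 1, j, j + 1] @ y \<and> v = x @ [j, j + 1, j] @ y)"

definition commutation_edges :: "nat list \<Rightarrow> (nat list \<times> nat list) set" where
  "commutation_edges \<pi> = {(u, v). u \<in> reduced_words \<pi> \<and> v \<in> reduced_words \<pi> \<and> commutation_move u v}"

definition long_braid_edges :: "nat list \<Rightarrow> (nat list \<times> nat list) set" where
  "long_braid_edges \<pi> = {(u, v). u \<in> reduced_words \<pi> \<and> v \<in> reduced_words \<pi> \<and> long_braid_move u v}"

text \<open>
  Undirected graphs are symmetric digraphs. Contracting a symmetric set \<open>F\<close> of edges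
  identifies vertices joined by a path in \<open>F\<close>; loops created by the contraction are dropped.
\<close>

definition contract_edges :: "'a pair_pre_digraph \<Rightarrow> ('a \<times> 'a) set \<Rightarrow> 'a set pair_pre_digraph" where
  "contract_edges G F =
     (let V = pverts G // {(u, v). u \<in> pverts G \<and> v \<in> pverts G \<and> (u, v) \<in> F\<^sup>*}
      in \<lparr>pverts = V,
          parcs = {(X, Y). X \<in> V \<and> Y \<in> V \<and> X \<noteq> Y \<and> (\<exists>u\<in>X. \<exists>v\<in>Y. (u, v) \<in> parcs G)}\<rparr>)"

definition G_graph :: "nat list \<Rightarrow> nat list pair_pre_digraph" where
  "G_graph \<pi> = \<lparr>pverts = reduced_words \<pi>, parcs = commutation_edges \<pi> \<union> long_braid_edges \<pi>\<rparr>"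

definition C_graph :: "nat list \<Rightarrow> nat list set pair_pre_digraph" where
  "C_graph \<pi> = contract_edges (G_graph \<pi>) (commutation_edges \<pi>)"

definition B_graph :: "nat list \<Rightarrow> nat list set pair_pre_digraph" where
  "B_graph \<pi> = contract_edges (G_graph \<pi>) (long_braid_edges \<pi>)"

text \<open>Distance is the shortest-path distance with all edge weights \<open>1\<close> (infinite if there is no path).\<close>

definition diam :: "'a pair_pre_digraph \<Rightarrow> ereal" where
  "diam G = (SUP u\<in>pverts G. SUP v\<in>pverts G. wf_digraph.\<mu> (with_proj G) (\<lambda>_. 1) u v)"

lemma finite_reduced_words: "finite (reduced_words \<pi>)"
proof (rule finite_subset)
  show "reduced_words \<pi> \<subseteq> {w. set w \<subseteq> {1..length \<pi> - 1} \<and> length w = inv_count \<pi>}"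
    by (auto simp: reduced_words_def)
qed (simp add: finite_lists_length_eq)

lemma sym_commutation_edges: "sym (commutation_edges \<pi>)"
  unfolding sym_def commutation_edges_def commutation_move_def by blast

lemma sym_long_braid_edges: "sym (long_braid_edges \<pi>)"
  unfolding sym_def long_braid_edges_def long_braid_move_def by blast

lemma pair_graph_G_graph: "pair_graph (G_graph \<pi>)"
proof
  show "finite (parcs (G_graph \<pi>))"
    by (rule finite_subset[of _ "reduced_words \<pi> \<times> reduced_words \<pi>"])
      (auto simp: G_graph_def commutation_edges_def long_braid_edges_def finite_reduced_words)
  show "symmetric (G_graph \<pi>)"
    using sym_Un[OF sym_commutation_edges sym_long_braid_edges]
    by (simp add: symmetric_def G_graph_def)
qed (auto simp: G_graph_def commutation_edges_def long_braid_edges_def commutation_move_def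
    long_braid_move_def finite_reduced_words)

lemma pair_graph_contract_edges:
  assumes "pair_graph G"
  shows "pair_graph (contract_edges G F)"
proof -
  interpret G: pair_graph G by fact
  let ?V = "pverts (contract_edges G F)"
  have fin: "finite ?V"
    unfolding contract_edges_def Let_def
    by (auto intro!: finite_quotient G.pair_finite_verts)
  show ?thesis
  proof
    show "finite (parcs (contract_edges G F))"
      by (rule finite_subset[of _ "?V \<times> ?V"]) (use fin in \<open>auto simp: contract_edges_def Let_def\<close>)
    have "sym (parcs G)"
      using G.pair_sym_arcs by (simp add: symmetric_def)
    then show "symmetric (contract_edges G F)"
      unfolding symmetric_def contract_edges_def Let_def sym_def by (simp; blast)
  qed (use fin in \<open>auto simp: contract_edges_def Let_def\<close>)
qed

lemma pair_graph_C_graph: "pair_graph (C_graph \<pi>)"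
  and pair_graph_B_graph: "pair_graph (B_graph \<pi>)"
  by (simp_all add: C_graph_def B_graph_def pair_graph_contract_edges pair_graph_G_graph)

end

theory Submission
  imports Defs
begin

text \<open>
  The letters of a reduced word of \<open>12[\<alpha>, \<beta>]\<close> split into a reduced word of \<open>\<alpha>\<close> and one of \<open>\<beta>\<close>,
  all letters of the first kind commuting with all letters of the second kind. A reduced word of
  \<open>21[1, \<sigma>]\<close>, of size \<open>n\<close>, is a reduced word of \<open>\<sigma>\<close> together with the crossings
  \<open>n - 1, \<dots>, 1\<close> of the wire of \<open>n\<close>, where each letter of the word of \<open>\<sigma>\<close> passes this wire
  by \<open>n - 3\<close> commutation moves and one long braid move. In both cases every move changes
  either the reduced word of a smaller permutation or an interleaving, and the number of moves
  separating the two extreme interleavings is the extra term in the diameter. Connectedness of the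
  graphs follows by induction along the decomposition.
\<close>

section \<open>Weighted paths between words\<close>

text \<open>The three formulas are one formula in the weights. Let l' and l'' be the inversion
  numbers of \<pi>' and \<pi>''. A reduced word of 21[1, \<pi>''] has n - m + l'' letters, each of
  which is exchanged once with each letter of \<pi>', so the direct sum contributes c * l' * (n - m
  + l''). The skew sum has size n - m + 1 and contributes l'' * (c * (n - m - 2) + b). The weights
  (1, 1), (0, 1) and (1, 0) turn the total into the extra terms of (i), (ii) and (iii). The delicate
  half is the lower bound: the costs add up only if no move makes progress on two components at
  once. So the interleaving is measured by a potential that stays constant whenever a projected word
  changes. For a direct sum it counts misordered pairs. In 21[1, \<sigma>] a letter may change its
  name while passing the wire, so the potential prices each letter by the position of the wire when
  that letter is read.\<close>

text \<open>
  A commutation move costs \<open>c\<close> and a long braid move costs \<open>b\<close>. Contracting a class of edges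
  amounts to making it free, so \<open>(c, b)\<close> is \<open>(1, 1)\<close>, \<open>(0, 1)\<close> and \<open>(1, 0)\<close> for the
  graphs \<open>G\<close>, \<open>C\<close> and \<open>B\<close>.
\<close>

definition move :: "nat \<Rightarrow> nat \<Rightarrow> nat \<Rightarrow> nat list \<Rightarrow> nat list \<Rightarrow> bool" where
  "move c b k u v \<longleftrightarrow> k = c \<and> commutation_move u v \<or> k = b \<and> long_braid_move u v"

inductive path :: "nat \<Rightarrow> nat \<Rightarrow> nat \<Rightarrow> nat list \<Rightarrow> nat list \<Rightarrow> bool" for c b where
  path_refl: "path c b 0 u u"
| path_snoc: "path c b k u v \<Longrightarrow> move c b j v w \<Longrightarrow> path c b (k + j) u w"

lemma commutation_move_sym: "commutation_move u v \<Longrightarrow> commutation_move v u"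
  unfolding commutation_move_def by blast

lemma long_braid_move_sym: "long_braid_move u v \<Longrightarrow> long_braid_move v u"
  unfolding long_braid_move_def by blast

lemma move_sym: "move c b k u v \<Longrightarrow> move c b k v u"
  unfolding move_def using commutation_move_sym long_braid_move_sym by blast

lemma move_path: "move c b k u v \<Longrightarrow> path c b k u v"
  using path_snoc[OF path_refl] by fastforce

lemma path_trans:
  assumes "path c b j v w" and "path c b i u v"
  shows "path c b (i + j) u w"
  using assms by induction (auto simp: add.assoc[symmetric] intro: path_snoc)

lemma path_sym:
  assumes "path c b k u v"
  shows "path c b k v u"
  using assms
proof induction
  case (path_snoc k u v j w)
  then show ?case
    using path_trans[of c b k v u j w] move_path[OF move_sym] by (simp add: add.commute)
qed (rule path_refl)

section \<open>Moves in context and under shifts\<close>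

lemma commutation_move_context:
  assumes "commutation_move u v"
  shows "commutation_move (x @ u @ y) (x @ v @ y)"
proof -
  from assms obtain p q j k where "j + 1 < k \<or> k + 1 < j" "u = p @ [j, k] @ q" "v = p @ [k, j] @ q"
    unfolding commutation_move_def by blast
  then show ?thesis
    unfolding commutation_move_def
    by (intro exI[of _ "x @ p"] exI[of _ "q @ y"] exI[of _ j] exI[of _ k]) auto
qed

lemma long_braid_moveI:
  "long_braid_move (x @ [j, j + 1, j] @ y) (x @ [j + 1, j, j + 1] @ y)"
  unfolding long_braid_move_def by blast

lemma long_braid_move_context:
  assumes "long_braid_move u v"
  shows "long_braid_move (x @ u @ y) (x @ v @ y)"
proof -
  from assms obtain p q j where
    "u = p @ [j, j + 1, j] @ q \<and> v = p @ [j + 1, j, j + 1] @ q \<or>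
     u = p @ [j + 1, j, j + 1] @ q \<and> v = p @ [j, j + 1, j] @ q"
    unfolding long_braid_move_def by blast
  then show ?thesis
    using long_braid_moveI[of "x @ p" j "q @ y"] long_braid_move_sym by auto
qed

lemma move_context: "move c b k u v \<Longrightarrow> move c b k (x @ u @ y) (x @ v @ y)"
  unfolding move_def using commutation_move_context long_braid_move_context by blast

lemma path_context: "path c b k u v \<Longrightarrow> path c b k (x @ u @ y) (x @ v @ y)"
  by (induction rule: path.induct) (auto intro: path_refl path_snoc move_context)

lemma move_map:
  assumes "move c b k u v"
  shows "move c b k (map (\<lambda>x. x + a) u) (map (\<lambda>x. x + a) v)"
proof -
  have "commutation_move (map (\<lambda>x. x + a) u) (map (\<lambda>x. x + a) v)" if "commutation_move u v"
  proof -
    from that obtain p q j k where "j + 1 < k \<or> k + 1 < j" "u = p @ [j, k] @ q" "v = p @ [k, j] @ q"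
      unfolding commutation_move_def by blast
    then show ?thesis
      unfolding commutation_move_def
      by (intro exI[of _ "map (\<lambda>x. x + a) p"] exI[of _ "map (\<lambda>x. x + a) q"] exI[of _ "j + a"]
          exI[of _ "k + a"]) auto
  qed
  moreover have "long_braid_move (map (\<lambda>x. x + a) u) (map (\<lambda>x. x + a) v)" if "long_braid_move u v"
  proof -
    from that obtain p q j where
      "u = p @ [j, j + 1, j] @ q \<and> v = p @ [j + 1, j, j + 1] @ q \<or>
       u = p @ [j + 1, j, j + 1] @ q \<and> v = p @ [j, j + 1, j] @ q"
      unfolding long_braid_move_def by blast
    then show ?thesis
      using long_braid_moveI[of "map (\<lambda>x. x + a) p" "j + a" "map (\<lambda>x. x + a) q"] long_braid_move_sym
      by auto
  qed
  ultimately show ?thesis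
    using assms unfolding move_def by blast
qed

lemma path_map: "path c b k u v \<Longrightarrow> path c b k (map (\<lambda>x. x + a) u) (map (\<lambda>x. x + a) v)"
  by (induction rule: path.induct) (auto intro: path_refl path_snoc move_map)

text \<open>The maximum is a natural number and is attained, so the statement includes connectedness
  of \<open>S\<close> and forces \<open>S\<close> to be nonempty; reduced words needed later are
  drawn from it.\<close>

definition has_diam :: "nat \<Rightarrow> nat \<Rightarrow> nat list set \<Rightarrow> nat \<Rightarrow> bool" where
  "has_diam c b S D \<longleftrightarrow> (\<forall>u\<in>S. \<forall>v\<in>S. \<exists>k\<le>D. path c b k u v) \<and>
     (\<exists>u\<in>S. \<exists>v\<in>S. \<forall>k. path c b k u v \<longrightarrow> D \<le> k)"

lemma has_diam_singleton: "has_diam c b {w} 0"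
  unfolding has_diam_def using path_refl by blast

text \<open>A word path descends to a walk no longer than its cost, because free moves stay inside a
  class. A walk lifts to a path whose cost is its length, because an arc can be realised at cost 1
  between any two representatives. With \<open>q\<close> the identity this covers the graph without
  contraction.\<close>

lemma diam_eqI:
  fixes H :: "'a pair_pre_digraph"
  assumes wf: "pair_graph H"
    and verts: "pverts H = q ` S"
    and closed: "\<And>k u v. u \<in> S \<Longrightarrow> move c b k u v \<Longrightarrow> v \<in> S"
    and fwd: "\<And>k u v. u \<in> S \<Longrightarrow> move c b k u v \<Longrightarrow> q u = q v \<or> 1 \<le> k \<and> (q u, q v) \<in> parcs H"
    and bwd: "\<And>u v. u \<in> S \<Longrightarrow> v \<in> S \<Longrightarrow> (q u, q v) \<in> parcs H \<Longrightarrow> path c b 1 u v"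
    and eq: "\<And>u v. u \<in> S \<Longrightarrow> v \<in> S \<Longrightarrow> q u = q v \<Longrightarrow> path c b 0 u v"
    and D: "has_diam c b S D"
  shows "diam H = ereal (real D)"
proof -
  interpret H: pair_graph H by fact
  have walk: "v \<in> S \<and> (\<exists>p. H.awalk (q u) p (q v) \<and> length p \<le> k)"
    if "path c b k u v" "u \<in> S" for k u v
    using that
  proof induction
    case (path_refl u)
    then have "H.awalk (q u) [] (q u)"
      using verts by (auto simp: H.awalk_Nil_iff)
    then show ?case using path_refl by fastforce
  next
    case (path_snoc k u v j w)
    then obtain p where p: "v \<in> S" "H.awalk (q u) p (q v)" "length p \<le> k" by blast
    have w: "w \<in> S" using closed p(1) path_snoc.hyps(2) by blast
    from fwd[OF p(1) path_snoc.hyps(2)] show ?case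
    proof
      assume "q v = q w"
      then show ?thesis using p w by (metis le_add1 le_trans)
    next
      assume a: "1 \<le> j \<and> (q v, q w) \<in> parcs H"
      then have "H.awalk (q v) [(q v, q w)] (q w)"
        using p(1) w verts by (simp add: H.awalk_Cons_iff H.awalk_Nil_iff)
      with p(2) have "H.awalk (q u) (p @ [(q v, q w)]) (q w)"
        by (rule H.awalk_appendI)
      then show ?thesis using a p w by (intro conjI exI[of _ "p @ [(q v, q w)]"]) auto
    qed
  qed
  have unwalk: "path c b (length p) u v" if "H.awalk (q u) p (q v)" "u \<in> S" "v \<in> S" for p u v
    using that
  proof (induction p arbitrary: u)
    case Nil
    then show ?case using eq by (auto simp: H.awalk_Nil_iff)
  next
    case (Cons e p)
    then have e: "e \<in> parcs H" "fst e = q u" and p: "H.awalk (snd e) p (q v)"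
      by (auto simp: H.awalk_Cons_iff)
    from p have "snd e \<in> pverts H" by (auto simp: H.awalk_def)
    then obtain u' where u': "u' \<in> S" "snd e = q u'" using verts by auto
    have "path c b 1 u u'" using bwd[OF Cons.prems(2) u'(1)] e u' by (metis prod.collapse)
    moreover have "path c b (length p) u' v" using Cons.IH[of u'] p u' Cons.prems by simp
    ultimately show ?case using path_trans[of c b "length p" u' v 1 u] by simp
  qed
  have cost: "H.awalk_cost (\<lambda>_. 1) p = real (length p)" for p
    by (induction p) auto
  have le: "H.\<mu> (\<lambda>_. 1) (q u) (q v) \<le> ereal (real D)" if uv: "u \<in> S" "v \<in> S" for u v
  proof -
    obtain k where "k \<le> D" "path c b k u v" using D uv unfolding has_diam_def by blast
    with walk[OF this(2) uv(1)] obtain p where p: "H.awalk (q u) p (q v)" "length p \<le> D"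
      using le_trans by blast
    then show ?thesis using H.min_cost_le_walk_cost[OF p(1), of "\<lambda>_. 1"] cost
      by (smt (verit) ereal_less_eq(3) of_nat_mono order_trans)
  qed
  obtain u v where uv: "u \<in> S" "v \<in> S" "\<And>k. path c b k u v \<Longrightarrow> D \<le> k"
    using D unfolding has_diam_def by blast
  have ge: "ereal (real D) \<le> H.\<mu> (\<lambda>_. 1) (q u) (q v)"
    unfolding H.\<mu>_def using unwalk[OF _ uv(1,2)] uv(3) by (auto intro!: INF_greatest simp: cost)
  show ?thesis
    unfolding diam_def
  proof (rule antisym)
    show "(SUP x\<in>pverts H. SUP y\<in>pverts H. H.\<mu> (\<lambda>_. 1) x y) \<le> ereal (real D)"
      using le verts by (auto intro!: SUP_least)
    have "ereal (real D) \<le> (SUP y\<in>pverts H. H.\<mu> (\<lambda>_. 1) (q u) y)"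
      using ge uv(2) verts by (auto intro: SUP_upper2)
    then show "ereal (real D) \<le> (SUP x\<in>pverts H. SUP y\<in>pverts H. H.\<mu> (\<lambda>_. 1) x y)"
      using uv(1) verts by (auto intro: SUP_upper2)
  qed
qed

text \<open>The contracted edges are exactly the free moves, so words of one class are joined by
  free paths, while an arc between different classes comes from a move of cost 1.\<close>

lemma diam_contract_edges:
  assumes G: "pair_graph G" "pverts G = S"
    and closed: "\<And>k u v. u \<in> S \<Longrightarrow> move c b k u v \<Longrightarrow> v \<in> S"
    and le1: "c \<le> 1" "b \<le> 1"
    and arcs: "parcs G = {(u, v). u \<in> S \<and> v \<in> S \<and> (\<exists>k. move c b k u v)}"
    and F: "F = {(u, v). u \<in> S \<and> v \<in> S \<and> move c b 0 u v}"
    and D: "has_diam c b S D"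
  shows "diam (contract_edges G F) = ereal (real D)"
proof -
  let ?R = "{(u, v). u \<in> S \<and> v \<in> S \<and> (u, v) \<in> F\<^sup>*}"
  let ?q = "\<lambda>u. ?R `` {u}"
  have symF: "sym (F\<^sup>*)"
    unfolding F by (intro sym_rtrancl symI) (auto intro: move_sym)
  have equiv: "equiv S ?R"
  proof (rule equivI)
    show "?R \<subseteq> S \<times> S" by auto
    show "refl_on S ?R" by (auto simp: refl_on_def)
    show "sym ?R" using symF by (auto simp: sym_def)
    show "trans ?R" by (auto simp: trans_def)
  qed
  have path0: "path c b 0 u v" if "(u, v) \<in> F\<^sup>*" for u v
    using that
  proof induction
    case (step v w)
    then show ?case using path_snoc[of c b 0 u v 0 w] by (auto simp: F)
  qed (rule path_refl)
  show ?thesis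
  proof (rule diam_eqI[where q = ?q and c = c and b = b and S = S])
    show "pair_graph (contract_edges G F)" by (rule pair_graph_contract_edges) fact
    show "pverts (contract_edges G F) = ?q ` S"
      unfolding contract_edges_def Let_def G(2) by (auto simp: quotient_def)
    show "v \<in> S" if "u \<in> S" "move c b k u v" for k u v using closed that .
    show "?q u = ?q v \<or> 1 \<le> k \<and> (?q u, ?q v) \<in> parcs (contract_edges G F)"
      if "u \<in> S" "move c b k u v" for k u v
    proof (cases "?q u = ?q v")
      case False
      have v: "v \<in> S" using closed that .
      have "k \<noteq> 0"
      proof
        assume "k = 0"
        then have "(u, v) \<in> ?R" using that v by (auto simp: F)
        then show False using False equiv_class_eq[OF equiv] by blast
      qed
      moreover have "u \<in> ?q u" "v \<in> ?q v" using that v by auto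
      moreover have "?q u \<in> S // ?R" "?q v \<in> S // ?R"
        using that v by (simp_all only: quotientI)
      moreover have "(u, v) \<in> parcs G" using that v arcs by auto
      ultimately show ?thesis
        using False unfolding contract_edges_def Let_def G(2) by auto
    qed simp
    show "path c b 1 u v" if uv: "u \<in> S" "v \<in> S" "(?q u, ?q v) \<in> parcs (contract_edges G F)" for u v
    proof -
      from uv(3) obtain u' v' where ne: "?q u \<noteq> ?q v" and u': "u' \<in> ?q u" and v': "v' \<in> ?q v"
        and "(u', v') \<in> parcs G"
        unfolding contract_edges_def Let_def G(2) by auto
      then obtain k where k: "move c b k u' v'" "u' \<in> S" "v' \<in> S" using arcs by auto
      have "k \<le> 1" using k le1 by (auto simp: move_def)
      \<comment> \<open>An arc between classes provides only some pair of representatives; free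
        paths inside the two classes connect it to \<open>u\<close> and \<open>v\<close>.\<close>
      have uu: "(u, u') \<in> ?R" and vv: "(v, v') \<in> ?R" using u' v' by auto
      have "k \<noteq> 0"
      proof
        assume "k = 0"
        then have "(u', v') \<in> ?R" using k by (auto simp: F)
        then have "?q u' = ?q v'" using equiv_class_eq[OF equiv] by blast
        with ne show False
          using equiv_class_eq[OF equiv uu] equiv_class_eq[OF equiv vv] by simp
      qed
      with \<open>k \<le> 1\<close> k(1) have "path c b 1 u' v'" using move_path by (metis le_neq_implies_less less_one)
      moreover have "path c b 0 u u'" "path c b 0 v' v" using path0 path_sym uu vv by auto
      ultimately show ?thesis
        using path_trans[of c b 1 u' v' 0 u] path_trans[of c b 0 v' v 1 u] by simp
    qed
    show "path c b 0 u v" if "u \<in> S" "v \<in> S" "?q u = ?q v" for u v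
    proof -
      have "(u, v) \<in> ?R" using eq_equiv_class[OF that(3) equiv that(2)] by simp
      then show ?thesis using path0 by auto
    qed
    show "has_diam c b S D" by fact
  qed
qed

section \<open>Reduced words as words of ascents\<close>

lemma simple_transp_simps:
  "simple_transp i x = (if x = i then i + 1 else if x = i + 1 then i else x)"
  unfolding simple_transp_def by (simp add: Transposition.transpose_def)

lemma simple_transp_comp_self: "simple_transp i \<circ> simple_transp i = id"
  by (auto simp: fun_eq_iff simple_transp_simps)

lemma word_prod_Nil [simp]: "word_prod [] = id"
  and word_prod_Cons: "word_prod (x # w) = simple_transp x \<circ> word_prod w"
  by (simp_all add: word_prod_def)

lemma word_prod_append: "word_prod (u @ v) = word_prod u \<circ> word_prod v"
  by (induction u) (simp_all add: word_prod_Cons comp_assoc)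

lemma word_prod_snoc: "word_prod (w @ [x]) = word_prod w \<circ> simple_transp x"
  by (simp add: word_prod_append word_prod_Cons)

lemma inj_word_prod: "inj (word_prod w)"
proof (induction w)
  case (Cons x w)
  have "inj (simple_transp x)"
    unfolding simple_transp_def by simp
  then show ?case
    unfolding word_prod_Cons using Cons by (rule inj_compose)
qed simp

lemma word_prod_fixes:
  assumes "\<And>y. y \<in> set w \<Longrightarrow> x \<noteq> y \<and> x \<noteq> y + 1"
  shows "word_prod w x = x"
  using assms by (induction w) (auto simp: word_prod_Cons simple_transp_simps)

lemma word_prod_mem:
  assumes "set w \<subseteq> {i..<j}" and "x \<in> {i..j}"
  shows "word_prod w x \<in> {i..j}"
  using assms by (induction w) (auto simp: word_prod_Cons simple_transp_simps)

lemma word_prod_map_add: "word_prod (map (\<lambda>x. x + a) w) (x + a) = word_prod w x + a"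
  by (induction w) (auto simp: word_prod_Cons simple_transp_simps)

lemma move_word_prod:
  assumes "move c b k u v"
  shows "word_prod u = word_prod v"
proof -
  have com: "word_prod (x @ [i, j] @ y) = word_prod (x @ [j, i] @ y)"
    if "i + 1 < j \<or> j + 1 < i" for i j x y
  proof -
    have "word_prod [i, j] = word_prod [j, i]"
      using that by (auto simp: fun_eq_iff word_prod_Cons simple_transp_simps)
    then show ?thesis by (simp only: word_prod_append)
  qed
  have braid: "word_prod (x @ [j, j + 1, j] @ y) = word_prod (x @ [j + 1, j, j + 1] @ y)" for j x y
  proof -
    have "word_prod [j, j + 1, j] = word_prod [j + 1, j, j + 1]"
      by (auto simp: fun_eq_iff word_prod_Cons simple_transp_simps)
    then show ?thesis by (simp only: word_prod_append)
  qed
  from assms consider "commutation_move u v" | "long_braid_move u v"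
    unfolding move_def by blast
  then show ?thesis
  proof cases
    case 1
    then show ?thesis unfolding commutation_move_def using com by blast
  next
    case 2
    then obtain x y j where "(u, v) = (x @ [j, j + 1, j] @ y, x @ [j + 1, j, j + 1] @ y) \<or>
        (v, u) = (x @ [j, j + 1, j] @ y, x @ [j + 1, j, j + 1] @ y)"
      unfolding long_braid_move_def by blast
    then show ?thesis using braid by (metis prod.inject)
  qed
qed

lemma move_length:
  assumes "move c b k u v"
  shows "length u = length v"
  using assms unfolding move_def commutation_move_def long_braid_move_def by auto

lemma move_set:
  assumes "move c b k u v"
  shows "set u = set v"
  using assms unfolding move_def commutation_move_def long_braid_move_def by auto

text \<open>Products compose from right to left, so appending x swaps the entries in positions x and
  x + 1; each letter is required to swap an ascent. Unlike a condition on the total length, this can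
  be tested letter by letter.\<close>

definition asc :: "nat list \<Rightarrow> bool" where
  "asc w \<longleftrightarrow> (\<forall>u x v. w = u @ x # v \<longrightarrow> word_prod u x < word_prod u (x + 1))"

lemma asc_Nil [simp]: "asc []"
  by (simp add: asc_def)

lemma asc_snoc: "asc (w @ [x]) \<longleftrightarrow> asc w \<and> word_prod w x < word_prod w (x + 1)"
proof
  assume a: "asc (w @ [x])"
  then show "asc w \<and> word_prod w x < word_prod w (x + 1)"
    unfolding asc_def by (metis append.assoc append_Cons)
next
  assume a: "asc w \<and> word_prod w x < word_prod w (x + 1)"
  show "asc (w @ [x])"
    unfolding asc_def
  proof (intro allI impI)
    fix u y v assume "w @ [x] = u @ y # v"
    then show "word_prod u y < word_prod u (y + 1)"
      using a unfolding asc_def by (cases v rule: rev_cases) auto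
  qed
qed

lemma asc_appendD: "asc (u @ v) \<Longrightarrow> asc u"
  by (induction v rule: rev_induct) (simp_all add: asc_snoc flip: append_assoc)

section \<open>Inversions and reducedness\<close>

definition inversions :: "nat \<Rightarrow> (nat \<Rightarrow> nat) \<Rightarrow> (nat \<times> nat) set" where
  "inversions n f = {(i, j). 1 \<le> i \<and> i < j \<and> j \<le> n \<and> f j < f i}"

lemma finite_inversions: "finite (inversions n f)"
  by (rule finite_subset[of _ "{..n} \<times> {..n}"]) (auto simp: inversions_def)

lemma inv_count_map: "inv_count (map f [1..<n + 1]) = card (inversions n f)"
proof -
  have "inversions n f = map_prod Suc Suc ` {(i, j). i < j \<and> j < n \<and> f (Suc j) < f (Suc i)}"
    (is "_ = _ ` ?A")
  proof (intro equalityI subsetI)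
    fix p assume "p \<in> inversions n f"
    then obtain i j where "p = (Suc i, Suc j)" "i < j" "j < n" "f (Suc j) < f (Suc i)"
      unfolding inversions_def by (cases p; cases "fst p"; cases "snd p") auto
    then show "p \<in> map_prod Suc Suc ` ?A" by auto
  qed (auto simp: inversions_def)
  moreover have "inj_on (map_prod Suc Suc) ?A" by (auto simp: inj_on_def)
  ultimately have "card (inversions n f) = card ?A" by (simp add: card_image)
  moreover have "?A = {(i, j). i < j \<and> j < length (map f [1..<n + 1]) \<and>
      map f [1..<n + 1] ! j < map f [1..<n + 1] ! i}"
    by (auto simp del: upt_Suc)
  ultimately show ?thesis unfolding inv_count_def by simp
qed

text \<open>Relabelling positions by the transposition carries old inversions to new ones, and the
  pair (x, x + 1) is the only one gained.\<close>

lemma card_inversions_ascent: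
  assumes "x \<in> {1..n - 1}" and "f x < f (x + 1)"
  shows "card (inversions n (f \<circ> simple_transp x)) = Suc (card (inversions n f))"
proof -
  let ?s = "simple_transp x"
  have "inversions n (f \<circ> ?s) = insert (x, x + 1) (map_prod ?s ?s ` inversions n f)"
  proof (intro equalityI subsetI)
    fix p assume p: "p \<in> inversions n (f \<circ> ?s)"
    obtain i j where ij: "p = (i, j)" by (cases p)
    show "p \<in> insert (x, x + 1) (map_prod ?s ?s ` inversions n f)"
    proof (cases "p = (x, x + 1)")
      case False
      then have "(?s i, ?s j) \<in> inversions n f"
        using p ij assms unfolding inversions_def
        by (auto simp: simple_transp_simps split: if_splits)
      moreover have "p = map_prod ?s ?s (?s i, ?s j)"
        using ij by (auto simp: simple_transp_simps)
      ultimately show ?thesis by blast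
    qed simp
  next
    fix p assume "p \<in> insert (x, x + 1) (map_prod ?s ?s ` inversions n f)"
    then show "p \<in> inversions n (f \<circ> ?s)"
      using assms unfolding inversions_def
      by (auto simp: simple_transp_simps split: if_splits)
  qed
  moreover have "(x, x + 1) \<notin> map_prod ?s ?s ` inversions n f"
  proof
    assume "(x, x + 1) \<in> map_prod ?s ?s ` inversions n f"
    then obtain i j where "?s i = x" "?s j = x + 1" "i < j"
      unfolding inversions_def by force
    then show False by (simp add: simple_transp_simps split: if_splits)
  qed
  moreover have "inj_on (map_prod ?s ?s) (inversions n f)"
    by (rule inj_on_subset[OF prod.inj_map]) (simp_all add: simple_transp_def)
  ultimately show ?thesis
    by (simp add: card_image finite_inversions)
qed

text \<open>Every letter raises or lowers the inversion number by one, so it reaches the length of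
  the word exactly when no letter lowers it.\<close>

lemma card_inversions_le_length:
  assumes "set w \<subseteq> {1..n - 1}"
  shows "card (inversions n (word_prod w)) \<le> length w \<and>
    (card (inversions n (word_prod w)) = length w \<longleftrightarrow> asc w)"
  using assms
proof (induction w rule: rev_induct)
  case Nil
  then show ?case by (auto simp: inversions_def card_eq_0_iff)
next
  case (snoc x w)
  let ?f = "word_prod w"
  have x: "x \<in> {1..n - 1}" using snoc.prems by simp
  have IH: "card (inversions n ?f) \<le> length w" "card (inversions n ?f) = length w \<longleftrightarrow> asc w"
    using snoc.IH snoc.prems by (simp_all only: set_append Un_subset_iff)
  have "?f x \<noteq> ?f (x + 1)"
    by (simp add: inj_eq[OF inj_word_prod])
  then consider "?f x < ?f (x + 1)" | "?f (x + 1) < ?f x" by linarith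
  then show ?case
  proof cases
    case 1
    have "card (inversions n (word_prod (w @ [x]))) = Suc (card (inversions n ?f))"
      unfolding word_prod_snoc by (rule card_inversions_ascent[where f = ?f, OF x 1])
    with IH 1 show ?thesis
      by (simp add: asc_snoc)
  next
    case 2
    \<comment> \<open>At a descent the ascent case is applied to the product after the swap;
      swapping twice restores \<open>?f\<close>.\<close>
    have "?f \<circ> simple_transp x \<circ> simple_transp x = ?f"
      by (simp only: comp_assoc simple_transp_comp_self comp_id)
    moreover have "(?f \<circ> simple_transp x) x < (?f \<circ> simple_transp x) (x + 1)"
      using 2 by (simp add: simple_transp_simps)
    ultimately have "card (inversions n ?f) = Suc (card (inversions n (word_prod (w @ [x]))))"
      using card_inversions_ascent[where f = "?f \<circ> simple_transp x", OF x] word_prod_snoc by metis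
    with IH 2 show ?thesis
      by (simp add: asc_snoc)
  qed
qed

lemma reduced_words_iff:
  "w \<in> reduced_words \<pi> \<longleftrightarrow> set w \<subseteq> {1..length \<pi> - 1} \<and>
     (\<forall>i<length \<pi>. word_prod w (i + 1) = \<pi> ! i) \<and> asc w"
proof -
  have "(map (word_prod w) [1..<length \<pi> + 1] = \<pi>) \<longleftrightarrow>
      (\<forall>i<length \<pi>. word_prod w (i + 1) = \<pi> ! i)"
    unfolding list_eq_iff_nth_eq by (simp del: upt_Suc)
  moreover have "length w = inv_count \<pi> \<longleftrightarrow> asc w"
    if "set w \<subseteq> {1..length \<pi> - 1}" "map (word_prod w) [1..<length \<pi> + 1] = \<pi>"
    using card_inversions_le_length[OF that(1)] inv_count_map[of "word_prod w" "length \<pi>"] that(2)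
    by auto
  ultimately show ?thesis unfolding reduced_words_def by auto
qed

lemma reduced_words_move:
  assumes "u \<in> reduced_words \<pi>" and "move c b k u v"
  shows "v \<in> reduced_words \<pi>"
  using assms move_set[OF assms(2)] move_length[OF assms(2)] move_word_prod[OF assms(2)]
  unfolding reduced_words_def by simp

lemma reduced_words_path:
  assumes "path c b k u v" and "u \<in> reduced_words \<pi>"
  shows "v \<in> reduced_words \<pi>"
  using assms by induction (auto intro: reduced_words_move)

lemma diam_graphs:
  shows diam_G_graph: "has_diam 1 1 (reduced_words \<pi>) D \<Longrightarrow> diam (G_graph \<pi>) = ereal (real D)"
    and diam_C_graph: "has_diam 0 1 (reduced_words \<pi>) D \<Longrightarrow> diam (C_graph \<pi>) = ereal (real D)"
    and diam_B_graph: "has_diam 1 0 (reduced_words \<pi>) D \<Longrightarrow> diam (B_graph \<pi>) = ereal (real D)"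
proof -
  have verts: "pverts (G_graph \<pi>) = reduced_words \<pi>"
    by (simp add: G_graph_def)
  \<comment> \<open>The weights are arbitrary here: they do not affect which words are
    joined.\<close>
  have arcs: "parcs (G_graph \<pi>) =
      {(u, v). u \<in> reduced_words \<pi> \<and> v \<in> reduced_words \<pi> \<and> (\<exists>k. move c b k u v)}" for c b
    by (auto simp: G_graph_def commutation_edges_def long_braid_edges_def move_def)
  note contr = diam_contract_edges[OF pair_graph_G_graph verts reduced_words_move _ _ arcs]
  show "has_diam 0 1 (reduced_words \<pi>) D \<Longrightarrow> diam (C_graph \<pi>) = ereal (real D)"
    unfolding C_graph_def by (rule contr) (auto simp: commutation_edges_def move_def)
  show "has_diam 1 0 (reduced_words \<pi>) D \<Longrightarrow> diam (B_graph \<pi>) = ereal (real D)"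
    unfolding B_graph_def by (rule contr) (auto simp: long_braid_edges_def move_def)
  assume D: "has_diam 1 1 (reduced_words \<pi>) D"
  show "diam (G_graph \<pi>) = ereal (real D)"
  proof (rule diam_eqI[where q = "\<lambda>u. u" and S = "reduced_words \<pi>", OF pair_graph_G_graph _ _ _ _ _ D])
    show "path 1 1 1 u v" if "(u, v) \<in> parcs (G_graph \<pi>)" for u v
      using that by (intro move_path)
        (auto simp: G_graph_def commutation_edges_def long_braid_edges_def move_def)
  qed (use reduced_words_move in \<open>auto simp: verts arcs[of 1 1] move_def intro: path_refl\<close>)
qed

section \<open>Diameters of fibred graphs\<close>

lemma path_append:
  assumes "path c b i u u'" and "path c b j v v'"
  shows "path c b (i + j) (u @ v) (u' @ v')"
  using path_trans[of c b j "u' @ v" "u' @ v'" i "u @ v"]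
    path_context[OF assms(1), of "[]" v] path_context[OF assms(2), of u' "[]"] by simp

lemma has_diam_path:
  assumes "has_diam c b S D" and "u \<in> S" and "v \<in> S"
  obtains k where "k \<le> D" and "path c b k u v"
  using assms unfolding has_diam_def by blast

lemma has_diam_far:
  assumes "has_diam c b S D"
  obtains u v where "u \<in> S" and "v \<in> S" and "\<And>k. path c b k u v \<Longrightarrow> D \<le> k"
  using assms unfolding has_diam_def by blast

text \<open>
  \<open>F\<close> and \<open>F'\<close> are the costs of moving a word to the sections \<open>lo\<close> and \<open>hi\<close> of its fibre.
  Since the routes from \<open>u\<close> to \<open>v\<close> through \<open>lo\<close> and through \<open>hi\<close> have fibre costs
  \<open>F u + F v\<close> and \<open>F' u + F' v\<close>, which add up to \<open>2M\<close>, one of them costs at most \<open>M\<close>.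
\<close>

lemma has_diam_fibration:
  fixes \<phi> \<psi> :: "nat list \<Rightarrow> nat list" and F F' :: "nat list \<Rightarrow> nat"
  assumes Y1: "has_diam c b Y1 D1" and Y2: "has_diam c b Y2 D2"
    and closed: "\<And>k u v. u \<in> X \<Longrightarrow> move c b k u v \<Longrightarrow> v \<in> X"
    and maps: "\<And>u. u \<in> X \<Longrightarrow> \<phi> u \<in> Y1 \<and> \<psi> u \<in> Y2"
    and step: "\<And>k u v. u \<in> X \<Longrightarrow> move c b k u v \<Longrightarrow>
      move c b k (\<phi> u) (\<phi> v) \<and> \<psi> v = \<psi> u \<and> F v = F u \<or>
      \<phi> v = \<phi> u \<and> move c b k (\<psi> u) (\<psi> v) \<and> F v = F u \<or>
      \<phi> v = \<phi> u \<and> \<psi> v = \<psi> u \<and> F v \<le> F u + k"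
    and lo: "\<And>y z. y \<in> Y1 \<Longrightarrow> z \<in> Y2 \<Longrightarrow>
      lo y z \<in> X \<and> \<phi> (lo y z) = y \<and> \<psi> (lo y z) = z \<and> F (lo y z) = 0"
    and hi: "\<And>y z. y \<in> Y1 \<Longrightarrow> z \<in> Y2 \<Longrightarrow>
      hi y z \<in> X \<and> \<phi> (hi y z) = y \<and> \<psi> (hi y z) = z \<and> F (hi y z) = M"
    and to_lo: "\<And>u. u \<in> X \<Longrightarrow> path c b (F u) u (lo (\<phi> u) (\<psi> u))"
    and to_hi: "\<And>u. u \<in> X \<Longrightarrow> path c b (F' u) u (hi (\<phi> u) (\<psi> u))"
    and sum: "\<And>u. u \<in> X \<Longrightarrow> F u + F' u = M"
    and lo_path: "\<And>i j y y' z z'. path c b i y y' \<Longrightarrow> path c b j z z' \<Longrightarrow>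
      path c b (i + j) (lo y z) (lo y' z')"
    and hi_path: "\<And>i j y y' z z'. path c b i y y' \<Longrightarrow> path c b j z z' \<Longrightarrow>
      path c b (i + j) (hi y z) (hi y' z')"
  shows "has_diam c b X (D1 + D2 + M)"
proof -
  have via: "path c b (i + (l + m) + j) u v"
    if "path c b i u x" "path c b j v y" "path c b (l + m) x y" for i j l m u v x y
    using path_trans[OF path_sym[OF that(2)] path_trans[OF that(3) that(1)]] by simp
  have upper: "\<exists>k\<le>D1 + D2 + M. path c b k u v" if uv: "u \<in> X" "v \<in> X" for u v
  proof -
    obtain l where l: "l \<le> D1" "path c b l (\<phi> u) (\<phi> v)"
      using has_diam_path[OF Y1] maps[OF uv(1)] maps[OF uv(2)] by blast
    obtain m where m: "m \<le> D2" "path c b m (\<psi> u) (\<psi> v)"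
      using has_diam_path[OF Y2] maps[OF uv(1)] maps[OF uv(2)] by blast
    have lo: "path c b (F u + (l + m) + F v) u v"
      using via[OF to_lo[OF uv(1)] to_lo[OF uv(2)] lo_path[OF l(2) m(2)]] .
    have hi: "path c b (F' u + (l + m) + F' v) u v"
      using via[OF to_hi[OF uv(1)] to_hi[OF uv(2)] hi_path[OF l(2) m(2)]] .
    have "F u + (l + m) + F v \<le> D1 + D2 + M \<or> F' u + (l + m) + F' v \<le> D1 + D2 + M"
      using sum[OF uv(1)] sum[OF uv(2)] l(1) m(1) by linarith
    then show ?thesis using lo hi by blast
  qed
  \<comment> \<open>Every move is charged to one projection or to the fibre. Bounding the increase
    of \<open>F\<close> suffices, since the path considered at the end climbs from 0 to
    \<open>M\<close>.\<close>
  have lower: "v \<in> X \<and> (\<exists>i j. path c b i (\<phi> u) (\<phi> v) \<and> path c b j (\<psi> u) (\<psi> v) \<and>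
      i + j + F v \<le> F u + k)"
    if "path c b k u v" "u \<in> X" for k u v
    using that
  proof induction
    case (path_refl u)
    then show ?case by (force intro: path.path_refl)
  next
    case (path_snoc k u v l w)
    then obtain i j where v: "v \<in> X" and ij: "path c b i (\<phi> u) (\<phi> v)"
      "path c b j (\<psi> u) (\<psi> v)" "i + j + F v \<le> F u + k" by blast
    have "w \<in> X" using closed v path_snoc.hyps(2) .
    moreover from step[OF v path_snoc.hyps(2)]
    have "\<exists>i j. path c b i (\<phi> u) (\<phi> w) \<and> path c b j (\<psi> u) (\<psi> w) \<and> i + j + F w \<le> F u + (k + l)"
    proof (elim disjE conjE)
      assume "move c b l (\<phi> v) (\<phi> w)" "\<psi> w = \<psi> v" "F w = F v"
      then show ?thesis using ij path.path_snoc[OF ij(1)]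
        by (intro exI[of _ "i + l"] exI[of _ j]) simp
    next
      assume "move c b l (\<psi> v) (\<psi> w)" "\<phi> w = \<phi> v" "F w = F v"
      then show ?thesis using ij path.path_snoc[OF ij(2)]
        by (intro exI[of _ i] exI[of _ "j + l"]) simp
    next
      assume "\<phi> w = \<phi> v" "\<psi> w = \<psi> v" "F w \<le> F v + l"
      then show ?thesis using ij
        by (intro exI[of _ i] exI[of _ j]) simp
    qed
    ultimately show ?case ..
  qed
  \<comment> \<open>The endpoints are chosen extreme for both projections and for the fibre
    simultaneously, so the three lower bounds add.\<close>
  obtain y y' where y: "y \<in> Y1" "y' \<in> Y1" "\<And>k. path c b k y y' \<Longrightarrow> D1 \<le> k"
    using has_diam_far[OF Y1] by metis
  obtain z z' where z: "z \<in> Y2" "z' \<in> Y2" "\<And>k. path c b k z z' \<Longrightarrow> D2 \<le> k"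
    using has_diam_far[OF Y2] by metis
  have "D1 + D2 + M \<le> k" if k: "path c b k (lo y z) (hi y' z')" for k
  proof -
    obtain i j where "path c b i y y'" "path c b j z z'" "i + j + M \<le> k"
      using lower[OF k] lo[OF y(1) z(1)] hi[OF y(2) z(2)] by auto
    then show ?thesis using y(3) z(3) by fastforce
  qed
  then show ?thesis
    unfolding has_diam_def using upper lo[OF y(1) z(1)] hi[OF y(2) z(2)] by blast
qed

section \<open>Elementary moves and their costs\<close>

lemma move_commute: "i + 1 < j \<or> j + 1 < i \<Longrightarrow> move c b c (x @ [i, j] @ y) (x @ [j, i] @ y)"
  unfolding move_def commutation_move_def by blast

lemma move_braid: "move c b b (x @ [j, j + 1, j] @ y) (x @ [j + 1, j, j + 1] @ y)"
  unfolding move_def using long_braid_moveI by blast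

lemma moveE:
  assumes "move c b k u v"
  obtains (commute) x y i j where "k = c" "i + 1 < j \<or> j + 1 < i" "u = x @ [i, j] @ y" "v = x @ [j, i] @ y"
  | (braid) x y j where "k = b" "u = x @ [j, j + 1, j] @ y" "v = x @ [j + 1, j, j + 1] @ y"
  | (braid') x y j where "k = b" "u = x @ [j + 1, j, j + 1] @ y" "v = x @ [j, j + 1, j] @ y"
proof -
  from assms have "k = c \<and> commutation_move u v \<or> k = b \<and> long_braid_move u v"
    by (simp only: move_def)
  then show thesis
  proof (elim disjE conjE)
    assume "k = c" "commutation_move u v"
    then show thesis
      unfolding commutation_move_def using commute by blast
  next
    assume "k = b" "long_braid_move u v"
    then show thesis
      unfolding long_braid_move_def using braid braid' by blast
  qed
qed

lemma commute_path:
  assumes "\<And>y. y \<in> set v \<Longrightarrow> y + 1 < x \<or> x + 1 < y"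
  shows "path c b (c * length v) (x # v) (v @ [x])"
  using assms
proof (induction v)
  case Nil
  then show ?case by (simp add: path_refl)
next
  case (Cons y v)
  have "path c b c (x # y # v) (y # x # v)"
    using move_commute[of x y c b "[]" v] Cons.prems by (auto intro: move_path)
  moreover have "path c b (c * length v) (y # x # v) (y # v @ [x])"
    using path_context[of c b _ _ _ "[y]" "[]"] Cons by fastforce
  ultimately show ?case
    using path_trans by fastforce
qed

section \<open>Direct sums\<close>

text \<open>The inversion number of an interleaving: pairs in which a \<open>P\<close>-letter
  precedes a \<open>Q\<close>-letter.\<close>

fun crossings :: "(nat \<Rightarrow> bool) \<Rightarrow> (nat \<Rightarrow> bool) \<Rightarrow> nat list \<Rightarrow> nat" where
  "crossings P Q [] = 0"
| "crossings P Q (x # w) = (if P x then length (filter Q w) else 0) + crossings P Q w"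

lemma crossings_append:
  "crossings P Q (u @ v) = crossings P Q u + length (filter P u) * length (filter Q v) + crossings P Q v"
  by (induction u) (auto simp: algebra_simps)

lemma crossings_eq_0: "filter P w = [] \<or> filter Q w = [] \<Longrightarrow> crossings P Q w = 0"
  by (induction w) (auto split: if_splits)

lemma crossings_add_swap:
  assumes "\<And>x. \<not> (P x \<and> Q x)"
  shows "crossings P Q w + crossings Q P w = length (filter P w) * length (filter Q w)"
  using assms by (induction w) auto

text \<open>Insertion sort from the right: a \<open>P\<close>-letter passes exactly the
  \<open>Q\<close>-letters behind it, so the cost counts the misordered pairs.\<close>

lemma sort_path:
  assumes "\<And>x y. x \<in> set w \<Longrightarrow> y \<in> set w \<Longrightarrow> P x \<Longrightarrow> Q y \<Longrightarrow> y + 1 < x \<or> x + 1 < y"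
    and "\<And>x. x \<in> set w \<Longrightarrow> P x \<noteq> Q x"
  shows "path c b (c * crossings P Q w) w (filter Q w @ filter P w)"
  using assms
proof (induction w)
  case Nil
  then show ?case by (simp add: path_refl)
next
  case (Cons x w)
  let ?Q = "filter Q w" and ?P = "filter P w"
  have "path c b (c * crossings P Q w) w (?Q @ ?P)"
    using Cons by simp
  then have IH: "path c b (c * crossings P Q w) (x # w) (x # ?Q @ ?P)"
    using path_context[of c b _ w _ "[x]" "[]"] by simp
  show ?case
  proof (cases "P x")
    case True
    then have "path c b (c * length ?Q) (x # ?Q) (?Q @ [x])"
      using Cons.prems(1)[of x] by (intro commute_path) auto
    then have "path c b (c * length ?Q) (x # ?Q @ ?P) (?Q @ x # ?P)"
      using path_context[of c b "c * length ?Q" "x # ?Q" "?Q @ [x]" "[]" ?P] by simp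
    from path_trans[OF this IH] show ?thesis
      using True Cons.prems(2)[of x] by (simp add: algebra_simps)
  next
    case False
    then show ?thesis using IH Cons.prems(2)[of x] by simp
  qed
qed

section \<open>Projections to the two summands\<close>

definition lower_part :: "nat \<Rightarrow> nat list \<Rightarrow> nat list" where
  "lower_part a w = filter (\<lambda>x. x < a) w"

definition upper_part :: "nat \<Rightarrow> nat list \<Rightarrow> nat list" where
  "upper_part a w = map (\<lambda>x. x - a) (filter (\<lambda>x. a < x) w)"

lemma map_add_upper_part: "map (\<lambda>x. x + a) (upper_part a w) = filter (\<lambda>x. a < x) w"
  by (induction w) (auto simp: upper_part_def)

lemma part_map_add:
  fixes u v :: "nat list"
  assumes "set u \<subseteq> {1..<a}" and "set v \<subseteq> {1..}"
  shows "filter (\<lambda>x. x < a) u = u" "filter (\<lambda>x. a < x) u = []"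
    "filter (\<lambda>x. x < a) (map (\<lambda>x. x + a) v) = []"
    "filter (\<lambda>x. a < x) (map (\<lambda>x. x + a) v) = map (\<lambda>x. x + a) v"
proof -
  show "filter (\<lambda>x. x < a) u = u" "filter (\<lambda>x. a < x) u = []"
    using assms(1) by (auto simp: filter_id_conv filter_empty_conv)
  show "filter (\<lambda>x. x < a) (map (\<lambda>x. x + a) v) = []"
    by (auto simp: filter_empty_conv)
  show "filter (\<lambda>x. a < x) (map (\<lambda>x. x + a) v) = map (\<lambda>x. x + a) v"
    using assms(2) by (auto simp: filter_id_conv)
qed

text \<open>As \<open>a\<close> does not occur, letters j and j + 1 of a braid lie on the same side
  of it, so a braid stays within one part, like a commutation on one side. A commutation across
  \<open>a\<close> leaves both parts alone and reverses one pair, which changes the scaled count by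
  its own price \<open>c\<close>.\<close>

lemma move_parts:
  assumes "a \<notin> set u" and "move c b k u v"
  shows "move c b k (lower_part a u) (lower_part a v) \<and> upper_part a v = upper_part a u \<and>
      c * crossings (\<lambda>x. a < x) (\<lambda>x. x < a) v = c * crossings (\<lambda>x. a < x) (\<lambda>x. x < a) u \<or>
    lower_part a v = lower_part a u \<and> move c b k (upper_part a u) (upper_part a v) \<and>
      c * crossings (\<lambda>x. a < x) (\<lambda>x. x < a) v = c * crossings (\<lambda>x. a < x) (\<lambda>x. x < a) u \<or>
    lower_part a v = lower_part a u \<and> upper_part a v = upper_part a u \<and>
      c * crossings (\<lambda>x. a < x) (\<lambda>x. x < a) v \<le> c * crossings (\<lambda>x. a < x) (\<lambda>x. x < a) u + k"
proof -
  let ?L = "lower_part a" and ?U = "upper_part a" and ?C = "crossings (\<lambda>x. a < x) (\<lambda>x. x < a)"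
  have L: "?L (x @ y) = ?L x @ ?L y" and U: "?U (x @ y) = ?U x @ ?U y" for x y
    by (simp_all add: lower_part_def upper_part_def)
  have seg: "move c b k (?L (x @ s @ y)) (?L (x @ t @ y)) \<and> ?U (x @ t @ y) = ?U (x @ s @ y) \<and>
        c * ?C (x @ t @ y) = c * ?C (x @ s @ y) \<or>
      ?L (x @ t @ y) = ?L (x @ s @ y) \<and> move c b k (?U (x @ s @ y)) (?U (x @ t @ y)) \<and>
        c * ?C (x @ t @ y) = c * ?C (x @ s @ y)"
    if "(\<forall>i\<in>set s. i < a) \<or> (\<forall>i\<in>set s. a < i)" "move c b k s t" 
      and "\<forall>i\<in>set s. a < i \<Longrightarrow> move c b k (map (\<lambda>x. x - a) s) (map (\<lambda>x. x - a) t)" for x y s t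
  proof -
    have st: "set t = set s" "length t = length s"
      using move_set[OF that(2)] move_length[OF that(2)] by simp_all
    from that(1) show ?thesis
    proof
      assume *: "\<forall>i\<in>set s. i < a"
      then have f: "filter (\<lambda>x. x < a) s = s" "filter (\<lambda>x. x < a) t = t"
        "filter (\<lambda>x. a < x) s = []" "filter (\<lambda>x. a < x) t = []"
        using st by (auto simp: filter_id_conv filter_empty_conv)
      then have "?C s = 0" "?C t = 0" by (simp_all add: crossings_eq_0)
      then show ?thesis
        using f st move_context[OF that(2)]
        unfolding L U crossings_append by (simp add: lower_part_def upper_part_def)
    next
      assume *: "\<forall>i\<in>set s. a < i"
      then have f: "filter (\<lambda>x. a < x) s = s" "filter (\<lambda>x. a < x) t = t"
        "filter (\<lambda>x. x < a) s = []" "filter (\<lambda>x. x < a) t = []"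
        using st by (auto simp: filter_id_conv filter_empty_conv)
      then have "?C s = 0" "?C t = 0" by (simp_all add: crossings_eq_0)
      then show ?thesis
        using f st move_context[OF that(3)[OF *]]
        unfolding L U crossings_append by (simp add: lower_part_def upper_part_def)
    qed
  qed
  from assms(2) show ?thesis
  proof (cases rule: moveE)
    case (commute x y i j)
    then have "i \<noteq> a" "j \<noteq> a" using assms(1) by auto
    then consider "(\<forall>l\<in>set [i, j]. l < a) \<or> (\<forall>l\<in>set [i, j]. a < l)" | "i < a \<and> a < j \<or> a < i \<and> j < a"
      by fastforce
    then show ?thesis
    proof cases
      case 1
      have "move c b k [i, j] [j, i]"
        using move_commute[of i j c b "[]" "[]"] commute by simp
      moreover have "move c b k (map (\<lambda>x. x - a) [i, j]) (map (\<lambda>x. x - a) [j, i])"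
        if "\<forall>l\<in>set [i, j]. a < l"
      proof -
        have "i - a + 1 < j - a \<or> j - a + 1 < i - a"
          using that commute(2) by (simp; linarith)
        then show ?thesis
          using move_commute[of "i - a" "j - a" c b "[]" "[]"] commute(1) by simp
      qed
      ultimately show ?thesis
        using seg[OF 1, of "[j, i]" x y] commute by blast
    next
      case 2
      then show ?thesis
        unfolding commute L U crossings_append
        by (auto simp: lower_part_def upper_part_def algebra_simps)
    qed
  next
    case (braid x y j)
    then have "(\<forall>l\<in>set [j, j + 1, j]. l < a) \<or> (\<forall>l\<in>set [j, j + 1, j]. a < l)"
      using assms(1) by auto
    moreover have "move c b k [j, j + 1, j] [j + 1, j, j + 1]"
      using move_braid[of c b "[]" j "[]"] braid by simp
    moreover have "move c b k (map (\<lambda>x. x - a) [j, j + 1, j]) (map (\<lambda>x. x - a) [j + 1, j, j + 1])"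
      if "\<forall>l\<in>set [j, j + 1, j]. a < l"
      using move_braid[of c b "[]" "j - a" "[]"] that braid by (auto simp: Suc_diff_le)
    ultimately show ?thesis
      using seg[of "[j, j + 1, j]" "[j + 1, j, j + 1]" x y] braid by blast
  next
    case (braid' x y j)
    then have "(\<forall>l\<in>set [j + 1, j, j + 1]. l < a) \<or> (\<forall>l\<in>set [j + 1, j, j + 1]. a < l)"
      using assms(1) by auto
    moreover have "move c b k [j + 1, j, j + 1] [j, j + 1, j]"
      using move_sym[OF move_braid[of c b "[]" j "[]"]] braid' by simp
    moreover have "move c b k (map (\<lambda>x. x - a) [j + 1, j, j + 1]) (map (\<lambda>x. x - a) [j, j + 1, j])"
      if "\<forall>l\<in>set [j + 1, j, j + 1]. a < l"
      using move_sym[OF move_braid[of c b "[]" "j - a" "[]"]] that braid' by (auto simp: Suc_diff_le)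
    ultimately show ?thesis
      using seg[of "[j + 1, j, j + 1]" "[j, j + 1, j]" x y] braid' by blast
  qed
qed

section \<open>Reduced words of a direct sum\<close>

lemma word_prod_ge:
  assumes "set w \<subseteq> {1..}" and "1 \<le> x"
  shows "1 \<le> word_prod w x"
  using assms by (induction w) (auto simp: word_prod_Cons simple_transp_simps)

lemma word_prod_merge:
  assumes "set u \<subseteq> {1..<a}" and "set v \<subseteq> {1..}"
  shows "x \<le> a \<Longrightarrow> word_prod (u @ map (\<lambda>x. x + a) v) x = word_prod u x"
    and "1 \<le> x \<Longrightarrow> word_prod (u @ map (\<lambda>x. x + a) v) (x + a) = word_prod v x + a"
proof -
  show "word_prod (u @ map (\<lambda>x. x + a) v) x = word_prod u x" if "x \<le> a"
  proof -
    have "word_prod (map (\<lambda>x. x + a) v) x = x"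
      using assms(2) that by (intro word_prod_fixes) auto
    then show ?thesis by (simp add: word_prod_append)
  qed
  show "word_prod (u @ map (\<lambda>x. x + a) v) (x + a) = word_prod v x + a" if "1 \<le> x"
  proof -
    have "1 \<le> word_prod v x" using word_prod_ge assms(2) that .
    then have "word_prod u (word_prod v x + a) = word_prod v x + a"
      using assms(1) by (intro word_prod_fixes) fastforce
    then show ?thesis by (simp add: word_prod_append word_prod_map_add)
  qed
qed

lemma asc_merge:
  assumes "set u \<subseteq> {1..<a}" and "set v \<subseteq> {1..}"
  shows "asc (u @ map (\<lambda>x. x + a) v) \<longleftrightarrow> asc u \<and> asc v"
  using assms(2)
proof (induction v rule: rev_induct)
  case (snoc x v)
  have "set v \<subseteq> {1..}" "1 \<le> x" using snoc.prems by auto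
  note prods = word_prod_merge(2)[OF assms(1) \<open>set v \<subseteq> {1..}\<close>]
  have "word_prod (u @ map (\<lambda>x. x + a) v) (x + a) = word_prod v x + a"
    using prods \<open>1 \<le> x\<close> by blast
  moreover have "word_prod (u @ map (\<lambda>x. x + a) v) (x + a + 1) = word_prod v (x + 1) + a"
    using prods[of "x + 1"] by (simp add: add.commute add.left_commute)
  moreover have "asc (u @ map (\<lambda>x. x + a) (v @ [x])) \<longleftrightarrow> asc (u @ map (\<lambda>x. x + a) v) \<and>
      word_prod (u @ map (\<lambda>x. x + a) v) (x + a) < word_prod (u @ map (\<lambda>x. x + a) v) (x + a + 1)"
    using asc_snoc[of "u @ map (\<lambda>x. x + a) v" "x + a"] by simp
  ultimately show ?case
    using snoc.IH[OF \<open>set v \<subseteq> {1..}\<close>] asc_snoc[of v x] by simp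
qed simp

lemma nth_inflate12:
  "inflate12 \<alpha> \<beta> ! i = (if i < length \<alpha> then \<alpha> ! i else \<beta> ! (i - length \<alpha>) + length \<alpha>)"
  if "i < length \<alpha> + length \<beta>"
  using that by (auto simp: inflate12_def nth_append)

lemma length_inflate12 [simp]: "length (inflate12 \<alpha> \<beta>) = length \<alpha> + length \<beta>"
  by (simp add: inflate12_def)

text \<open>Both directions are needed: one supplies the section \<open>lo\<close>, the other shows
  that the two projections of a sorted word are reduced.\<close>

lemma merge_reduced_words_iff:
  assumes "set u \<subseteq> {1..<length \<alpha>}" and "set v \<subseteq> {1..}"
  shows "u @ map (\<lambda>x. x + length \<alpha>) v \<in> reduced_words (inflate12 \<alpha> \<beta>) \<longleftrightarrow>
    u \<in> reduced_words \<alpha> \<and> v \<in> reduced_words \<beta>"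
proof -
  let ?a = "length \<alpha>" and ?l = "length \<beta>"
  let ?w = "u @ map (\<lambda>x. x + ?a) v"
  note prods = word_prod_merge[OF assms]
  have "set ?w \<subseteq> {1..?a + ?l - 1} \<longleftrightarrow> set u \<subseteq> {1..?a - 1} \<and> set v \<subseteq> {1..?l - 1}"
    using assms by (auto simp: subset_iff) (force+)
  moreover have "(\<forall>i<?a + ?l. word_prod ?w (i + 1) = inflate12 \<alpha> \<beta> ! i) \<longleftrightarrow>
      (\<forall>i<?a. word_prod u (i + 1) = \<alpha> ! i) \<and> (\<forall>i<?l. word_prod v (i + 1) = \<beta> ! i)"
    (is "?L \<longleftrightarrow> ?R1 \<and> ?R2")
  proof -
    have small: "word_prod ?w (i + 1) = inflate12 \<alpha> \<beta> ! i \<longleftrightarrow> word_prod u (i + 1) = \<alpha> ! i" if "i < ?a" for i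
      using that prods(1)[of "i + 1"] by (simp add: nth_inflate12)
    have large: "word_prod ?w (i + ?a + 1) = inflate12 \<alpha> \<beta> ! (i + ?a) \<longleftrightarrow> word_prod v (i + 1) = \<beta> ! i"
      if "i < ?l" for i
    proof -
      have "word_prod ?w (i + ?a + 1) = word_prod v (i + 1) + ?a"
        using prods(2)[of "i + 1"] by (simp add: add.commute add.left_commute)
      then show ?thesis using that by (simp add: nth_inflate12)
    qed
    have split: "(\<forall>i<?a + ?l. Q i) \<longleftrightarrow> (\<forall>i<?a. Q i) \<and> (\<forall>i<?l. Q (i + ?a))" for Q
    proof (intro iffI conjI allI impI)
      fix i assume *: "(\<forall>i<?a. Q i) \<and> (\<forall>i<?l. Q (i + ?a))" "i < ?a + ?l"
      show "Q i"
      proof (cases "i < ?a")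
        case False
        then have "i - ?a < ?l" "i = i - ?a + ?a" using *(2) by auto
        then show ?thesis using * by metis
      qed (use * in blast)
    qed auto
    show ?thesis
      unfolding split using small large by blast
  qed
  ultimately show ?thesis
    unfolding reduced_words_iff length_inflate12 using asc_merge[OF assms] by blast
qed

text \<open>
  The sum over the first \<open>a\<close> positions never decreases along a word of ascents and increases
  strictly at each letter \<open>a\<close>; hence a permutation preserving \<open>{1..a}\<close> has no reduced word
  containing \<open>a\<close>.
\<close>

lemma asc_sum_prefix:
  assumes "asc w" and "set w \<subseteq> {1..}"
  shows "\<Sum>{1..a} \<le> (\<Sum>i\<in>{1..a}. word_prod w i) \<and>
    (a \<in> set w \<longrightarrow> \<Sum>{1..a} < (\<Sum>i\<in>{1..a}. word_prod w i))"
  using assms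
proof (induction w rule: rev_induct)
  case (snoc x w)
  let ?f = "word_prod w"
  have x: "1 \<le> x" and asc: "asc w" "?f x < ?f (x + 1)" using snoc.prems by (auto simp: asc_snoc)
  have IH: "\<Sum>{1..a} \<le> (\<Sum>i\<in>{1..a}. ?f i)" "a \<in> set w \<longrightarrow> \<Sum>{1..a} < (\<Sum>i\<in>{1..a}. ?f i)"
    using snoc.IH asc(1) snoc.prems(2) by auto
  have step: "(\<Sum>i\<in>{1..a}. word_prod (w @ [x]) i) = (\<Sum>i\<in>{1..a}. ?f (simple_transp x i))"
    by (simp add: word_prod_snoc)
  consider "x < a" | "x = a" | "a < x" by linarith
  then show ?case
  proof cases
    case 1
    then have "simple_transp x permutes {1..a}"
      unfolding simple_transp_def using x by (intro permutes_swap_id) auto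
    from sum.permute[OF this, of ?f] show ?thesis
      using IH 1 unfolding step by (simp add: comp_def)
  next
    case 2
    have a: "{1..a} = insert a {1..<a}" using x 2 by auto
    have "(\<Sum>i\<in>{1..<a}. ?f (simple_transp x i)) = (\<Sum>i\<in>{1..<a}. ?f i)"
      using 2 by (intro sum.cong) (auto simp: simple_transp_simps)
    then have "(\<Sum>i\<in>{1..a}. ?f (simple_transp x i)) = ?f (a + 1) + (\<Sum>i\<in>{1..<a}. ?f i)"
      unfolding a using 2 by (simp add: simple_transp_simps)
    moreover have "(\<Sum>i\<in>{1..a}. ?f i) = ?f a + (\<Sum>i\<in>{1..<a}. ?f i)"
      unfolding a by simp
    ultimately have "(\<Sum>i\<in>{1..a}. ?f i) < (\<Sum>i\<in>{1..a}. ?f (simple_transp x i))"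
      using asc(2) 2 by simp
    then show ?thesis using IH(1) unfolding step by linarith
  next
    case 3
    then have "(\<Sum>i\<in>{1..a}. ?f (simple_transp x i)) = (\<Sum>i\<in>{1..a}. ?f i)"
      by (intro sum.cong) (auto simp: simple_transp_simps)
    then show ?thesis using IH 3 unfolding step by auto
  qed
qed simp

lemma length_notin_reduced_word:
  assumes "\<alpha> \<in> permutations_of_set {1..length \<alpha>}" and "w \<in> reduced_words (inflate12 \<alpha> \<beta>)"
  shows "length \<alpha> \<notin> set w"
proof -
  let ?a = "length \<alpha>"
  have w: "set w \<subseteq> {1..}" "asc w" "\<And>i. i < ?a \<Longrightarrow> word_prod w (i + 1) = \<alpha> ! i"
    using assms(2) by (auto simp: reduced_words_iff nth_inflate12)
  have "(\<Sum>i\<in>{1..?a}. word_prod w i) = (\<Sum>i<?a. word_prod w (i + 1))"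
    by (rule sum.reindex_bij_witness[of _ "\<lambda>i. i + 1" "\<lambda>i. i - 1"]) auto
  also have "\<dots> = sum_list \<alpha>"
    using w(3) by (simp add: sum_list_sum_nth atLeast0LessThan)
  also have "\<dots> = \<Sum>{1..?a}"
    using assms(1) by (metis permutations_of_setD sum_list_distinct_conv_sum_set list.map_ident)
  finally show ?thesis
    using asc_sum_prefix[OF w(2,1), of ?a] by auto
qed

lemma has_diam_inflate12:
  assumes "\<alpha> \<in> permutations_of_set {1..length \<alpha>}"
    and \<alpha>: "has_diam c b (reduced_words \<alpha>) D1" and \<beta>: "has_diam c b (reduced_words \<beta>) D2"
  shows "has_diam c b (reduced_words (inflate12 \<alpha> \<beta>)) (D1 + D2 + c * (inv_count \<alpha> * inv_count \<beta>))"
proof -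
  let ?a = "length \<alpha>"
  let ?X = "reduced_words (inflate12 \<alpha> \<beta>)"
  let ?sh = "map (\<lambda>x. x + ?a)"
  let ?F = "\<lambda>w. c * crossings (\<lambda>x. ?a < x) (\<lambda>x. x < ?a) w"
  let ?F' = "\<lambda>w. c * crossings (\<lambda>x. x < ?a) (\<lambda>x. ?a < x) w"
  have notin: "?a \<notin> set w" if "w \<in> ?X" for w
    using length_notin_reduced_word[OF assms(1) that] .
  have side: "x < ?a \<longleftrightarrow> \<not> ?a < x" if "w \<in> ?X" "x \<in> set w" for w x
    using notin[OF that(1)] that(2) by (metis linorder_neqE_nat less_asym)
  have to_lo: "path c b (?F w) w (lower_part ?a w @ ?sh (upper_part ?a w))" if "w \<in> ?X" for w
    unfolding lower_part_def map_add_upper_part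
    by (intro sort_path, linarith) (use side[OF that] in blast)
  have to_hi: "path c b (?F' w) w (?sh (upper_part ?a w) @ lower_part ?a w)" if "w \<in> ?X" for w
    unfolding lower_part_def map_add_upper_part
    by (intro sort_path, linarith) (use side[OF that] in blast)
  have parts: "lower_part ?a w \<in> reduced_words \<alpha> \<and> upper_part ?a w \<in> reduced_words \<beta>"
    if w: "w \<in> ?X" for w
  proof -
    have "set w \<subseteq> {1..}" using w by (auto simp: reduced_words_iff)
    then have "set (lower_part ?a w) \<subseteq> {1..<?a}" "set (upper_part ?a w) \<subseteq> {1..}"
      by (auto simp: lower_part_def upper_part_def)
    \<comment> \<open>Sorting \<open>w\<close> by moves keeps it reduced and brings it into merged
      form, where the two halves can be read off.\<close>
    from merge_reduced_words_iff[OF this] show ?thesis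
      using reduced_words_path[OF to_lo[OF w] w] by blast
  qed
  have bounds: "set u \<subseteq> {1..<?a}" "set v \<subseteq> {1..}"
    if "u \<in> reduced_words \<alpha>" "v \<in> reduced_words \<beta>" for u v
    using that by (fastforce simp: reduced_words_iff)+
  have lo: "u @ ?sh v \<in> ?X \<and> lower_part ?a (u @ ?sh v) = u \<and> upper_part ?a (u @ ?sh v) = v \<and>
      ?F (u @ ?sh v) = 0"
    if uv: "u \<in> reduced_words \<alpha>" "v \<in> reduced_words \<beta>" for u v
    using part_map_add[OF bounds[OF uv]] merge_reduced_words_iff[OF bounds[OF uv]] uv
    by (simp add: lower_part_def upper_part_def comp_def crossings_append crossings_eq_0)
  have hi: "?sh v @ u \<in> ?X \<and> lower_part ?a (?sh v @ u) = u \<and> upper_part ?a (?sh v @ u) = v \<and>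
      ?F (?sh v @ u) = c * (inv_count \<alpha> * inv_count \<beta>)"
    if uv: "u \<in> reduced_words \<alpha>" "v \<in> reduced_words \<beta>" for u v
  proof -
    \<comment> \<open>The word is reached by moves from the opposite order, hence it is
      reduced.\<close>
    have "?sh v @ u \<in> ?X"
      using reduced_words_path[OF to_hi, of "u @ ?sh v" "inflate12 \<alpha> \<beta>"] lo[OF uv] by simp
    moreover have "length u = inv_count \<alpha>" "length v = inv_count \<beta>"
      using uv by (simp_all add: reduced_words_def)
    ultimately show ?thesis
      using part_map_add[OF bounds[OF uv]]
      by (simp add: lower_part_def upper_part_def comp_def crossings_append crossings_eq_0 mult.commute)
  qed
  show ?thesis
  proof (rule has_diam_fibration[OF \<alpha> \<beta>, where X = ?X and F = ?F and F' = ?F' and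
        \<phi> = "lower_part ?a" and \<psi> = "upper_part ?a" and
        lo = "\<lambda>u v. u @ ?sh v" and hi = "\<lambda>u v. ?sh v @ u"])
    show "v \<in> ?X" if "u \<in> ?X" "move c b k u v" for k u v
      using reduced_words_move that .
    show "move c b k (lower_part ?a u) (lower_part ?a v) \<and> upper_part ?a v = upper_part ?a u \<and> ?F v = ?F u \<or>
      lower_part ?a v = lower_part ?a u \<and> move c b k (upper_part ?a u) (upper_part ?a v) \<and> ?F v = ?F u \<or>
      lower_part ?a v = lower_part ?a u \<and> upper_part ?a v = upper_part ?a u \<and> ?F v \<le> ?F u + k"
      if "u \<in> ?X" "move c b k u v" for k u v
      using move_parts[OF notin[OF that(1)] that(2)] .
    show "?F u + ?F' u = c * (inv_count \<alpha> * inv_count \<beta>)" if "u \<in> ?X" for u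
    proof -
      have "length (lower_part ?a u) = inv_count \<alpha>" "length (upper_part ?a u) = inv_count \<beta>"
        using parts[OF that] by (simp_all add: reduced_words_def)
      moreover have "?F u + ?F' u = c * (length (filter (\<lambda>x. ?a < x) u) * length (filter (\<lambda>x. x < ?a) u))"
        unfolding add_mult_distrib2[symmetric] by (subst crossings_add_swap) auto
      ultimately show ?thesis by (simp add: lower_part_def upper_part_def mult.commute)
    qed
    show "path c b (i + j) (y @ ?sh z) (y' @ ?sh z')" if "path c b i y y'" "path c b j z z'" for i j y y' z z'
      by (rule path_append[OF that(1) path_map[OF that(2)]])
    show "path c b (i + j) (?sh z @ y) (?sh z' @ y')" if "path c b i y y'" "path c b j z z'" for i j y y' z z'
      using path_append[OF path_map[OF that(2), of ?a] that(1)] by (simp only: add.commute)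
  qed (use parts lo hi to_lo to_hi in blast)+
qed

section \<open>Skew sums with a single point\<close>

text \<open>
  In the wiring diagram of \<open>21[1, \<sigma>]\<close> the wire of the largest value \<open>n\<close> runs from position \<open>n\<close>
  to position \<open>1\<close> and crosses every other wire once. Below, \<open>p\<close> is its current position: a
  letter \<open>x\<close> with \<open>x + 1 = p\<close> is a crossing with it, while a letter \<open>x\<close> with \<open>x + 1 < p\<close> or \<open>x > p\<close>
  is a crossing of two other wires that it has still to pass or has already passed; deleting the
  wire turns such a letter into \<open>x\<close> or \<open>x - 1\<close>. Pushing such a letter to the left of all
  crossings of the wire costs \<open>c\<close> for each of the \<open>n - p\<close> crossings before it, except that for
  \<open>x > p\<close> two of these crossings are passed together by one long braid move; pushing it to the
  right works likewise with the \<open>p - 1\<close> crossings after it.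
\<close>

fun wire_end :: "nat \<Rightarrow> nat list \<Rightarrow> nat" where
  "wire_end p [] = p"
| "wire_end p (x # w) = wire_end (if x + 1 = p then x else p) w"

fun descends :: "nat \<Rightarrow> nat list \<Rightarrow> bool" where
  "descends p [] = True"
| "descends p (x # w) = (if x + 1 = p then descends x w else x \<noteq> p \<and> descends p w)"

fun delete_wire :: "nat \<Rightarrow> nat list \<Rightarrow> nat list" where
  "delete_wire p [] = []"
| "delete_wire p (x # w) = (if x + 1 = p then delete_wire x w
     else (if x < p then x else x - 1) # delete_wire p w)"

fun cost_left :: "nat \<Rightarrow> nat \<Rightarrow> nat \<Rightarrow> nat \<Rightarrow> nat list \<Rightarrow> nat" where
  "cost_left c b n p [] = 0"
| "cost_left c b n p (x # w) = (if x + 1 = p then cost_left c b n x w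
     else (if x < p then c * (n - p) else c * (n - p - 2) + b) + cost_left c b n p w)"

fun cost_right :: "nat \<Rightarrow> nat \<Rightarrow> nat \<Rightarrow> nat list \<Rightarrow> nat" where
  "cost_right c b p [] = 0"
| "cost_right c b p (x # w) = (if x + 1 = p then cost_right c b x w
     else (if x < p then c * (p - 3) + b else c * (p - 1)) + cost_right c b p w)"

lemma wire_append:
  "wire_end p (u @ v) = wire_end (wire_end p u) v"
  "descends p (u @ v) \<longleftrightarrow> descends p u \<and> descends (wire_end p u) v"
  "delete_wire p (u @ v) = delete_wire p u @ delete_wire (wire_end p u) v"
  "cost_left c b n p (u @ v) = cost_left c b n p u + cost_left c b n (wire_end p u) v"
  by (induction u arbitrary: p) simp_all

section \<open>The wire under single moves\<close>

lemma wire_end_bounds: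
  assumes "0 \<notin> set w" and "1 \<le> p"
  shows "1 \<le> wire_end p w \<and> wire_end p w \<le> p"
  using assms
proof (induction w arbitrary: p)
  case (Cons x w)
  let ?q = "if x + 1 = p then x else p"
  have "1 \<le> ?q" "?q \<le> p" "0 \<notin> set w" using Cons.prems by auto
  with Cons.IH[of ?q] have "1 \<le> wire_end ?q w" "wire_end ?q w \<le> p" by linarith+
  then show ?case by (simp only: wire_end.simps)
qed simp

text \<open>Exchanging a letter with a crossing of the wire changes the wire position at which the
  letter is priced by one. For letters already passed only inequalities are stated, because n - p -
  2 is a truncated difference.\<close>

lemma cost_step:
  fixes c :: nat
  assumes "i + 1 = p" and "p \<le> n"
  shows "c * (n - i) = c * (n - p) + c" and "c * (n - i - 2) \<le> c * (n - p - 2) + c"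
    and "c * (n - p - 2) \<le> c * (n - i - 2) + c"
proof -
  obtain m where "n = p + m" using assms(2) le_Suc_ex by blast
  moreover have "c * (m - 1) \<le> c * (m - 2) + c" "c * (m - 2) \<le> c * (m - 1) + c"
    using mult_le_mono2[of "m - 1" "(m - 2) + 1" c] mult_le_mono2[of "m - 2" "(m - 1) + 1" c]
    by (simp_all add: algebra_simps)
  ultimately show "c * (n - i) = c * (n - p) + c" "c * (n - i - 2) \<le> c * (n - p - 2) + c"
    "c * (n - p - 2) \<le> c * (n - i - 2) + c"
    using assms(1) by auto
qed

text \<open>From one end to the other a letter passes all n - 1 crossings of the wire, two of them
  by the braid, so its two prices add up to c * (n - 3) + b wherever the wire is. Nothing truncates:
  x + 1 < p gives p \<ge> 3, and p < x < n gives n \<ge> p + 2.\<close>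

lemma cost_sum:
  assumes "set w \<subseteq> {1..<n}" and "descends p w" and "1 \<le> p" and "p \<le> n"
  shows "cost_left c b n p w + cost_right c b p w = length (delete_wire p w) * (c * (n - 3) + b)"
  using assms
proof (induction w arbitrary: p)
  case (Cons x w)
  have x: "1 \<le> x" "x < n" "set w \<subseteq> {1..<n}" using Cons.prems by auto
  have "x \<noteq> p" using Cons.prems by (auto split: if_splits)
  then consider "x + 1 = p" | "x + 1 < p" | "p < x" by linarith
  then show ?case
  proof cases
    case 1
    then show ?thesis using Cons.IH[of x] Cons.prems x by simp
  next
    case 2
    have "c * (n - p) + c * (p - 3) = c * (n - 3)"
      unfolding add_mult_distrib2[symmetric] using 2 x Cons.prems(4) by simp
    then show ?thesis using Cons.IH[of p] Cons.prems x 2 by simp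
  next
    case 3
    have "c * (n - p - 2) + c * (p - 1) = c * (n - 3)"
      unfolding add_mult_distrib2[symmetric] using 3 x Cons.prems(3) by simp
    then show ?thesis using Cons.IH[of p] Cons.prems x 3 by simp
  qed
qed simp

text \<open>If the wire takes no part in the move, deleting it leaves a move of the same kind and
  all prices stay. If it does, the deleted word stays and only the place where one other letter
  meets the wire changes.\<close>

lemma move_wire_segment:
  assumes "move c b k s t" and "s = [i, j] \<and> t = [j, i] \<and> (i + 1 < j \<or> j + 1 < i) \<and> k = c \<or>
      k = b \<and> (s = [j, j + 1, j] \<and> t = [j + 1, j, j + 1] \<or> s = [j + 1, j, j + 1] \<and> t = [j, j + 1, j])"
    and "descends p s" and "descends p t" and "p \<le> n"
  shows "wire_end p t = wire_end p s \<and>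
    (move c b k (delete_wire p s) (delete_wire p t) \<and> cost_left c b n p t = cost_left c b n p s \<or>
     delete_wire p t = delete_wire p s \<and> cost_left c b n p t \<le> cost_left c b n p s + k)"
proof -
  consider (comm) "s = [i, j]" "t = [j, i]" "i + 1 < j \<or> j + 1 < i" "k = c"
    | (braid) "s = [j, j + 1, j]" "t = [j + 1, j, j + 1]" "k = b"
    | (braid') "s = [j + 1, j, j + 1]" "t = [j, j + 1, j]" "k = b"
    using assms(2) by argo
  then show ?thesis
  proof cases
    case comm
    note st = comm(1,2) and ij = comm(3)
    let ?r = "\<lambda>x. if x < p then x else x - 1"
    consider "i + 1 = p" | "j + 1 = p" | "i + 1 \<noteq> p" "j + 1 \<noteq> p" by blast
    then show ?thesis
    proof cases
      case 1
      note cost_step[OF this \<open>p \<le> n\<close>, of c]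
      then show ?thesis using 1 ij st \<open>k = c\<close> assms(3,4) by auto
    next
      case 2
      note cost_step[OF this \<open>p \<le> n\<close>, of c]
      then show ?thesis using 2 ij st \<open>k = c\<close> assms(3,4) by auto
    next
      case 3
      \<comment> \<open>Only letters on different sides of p come closer. There the smaller is at
        most p - 2 and the larger at least p + 1, so a gap of two remains after the shift.\<close>
      then have "?r i + 1 < ?r j \<or> ?r j + 1 < ?r i"
        using ij assms(3,4) st by (auto split: if_splits)
      from move_commute[OF this, of c b "[]" "[]"] have "move c b k [?r i, ?r j] [?r j, ?r i]"
        using \<open>k = c\<close> by simp
      then show ?thesis using 3 ij st by simp
    qed
  next
    case braid
    note st = braid(1,2)
    \<comment> \<open>Starting at position j or j + 1, the wire would have to move up in one of the
      two words; if it takes part, it starts at j + 2.\<close>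
    have "j \<noteq> p" "j + 1 \<noteq> p"
      using assms(3,4) st by (auto split: if_splits)
    then consider "j + 2 = p" | "j + 2 < p" | "p < j" by linarith
    then show ?thesis
    proof cases
      case 1
      \<comment> \<open>The remaining letter is priced c * (n - p) before the two crossings and c *
        (n - j - 2) + b after them, a difference of exactly \<open>b\<close>.\<close>
      then have "n - p = n - j - 2" by simp
      then show ?thesis using 1 st \<open>k = b\<close> by simp
    next
      case 2
      then show ?thesis using assms(1) st by simp
    next
      case 3
      then show ?thesis using move_braid[of c b "[]" "j - 1" "[]"] st \<open>k = b\<close> by simp
    qed
  next
    case braid'
    note st = braid'(1,2)
    have "j \<noteq> p" "j + 1 \<noteq> p"
      using assms(3,4) st by (auto split: if_splits)
    then consider "j + 2 = p" | "j + 2 < p" | "p < j" by linarith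
    then show ?thesis
    proof cases
      case 1
      then have "n - p = n - j - 2" by simp
      then show ?thesis using 1 st \<open>k = b\<close> by simp
    next
      case 2
      then show ?thesis using assms(1) st by simp
    next
      case 3
      then show ?thesis using move_sym[OF move_braid[of c b "[]" "j - 1" "[]"]] st \<open>k = b\<close> by simp
    qed
  qed
qed

lemma move_delete_wire:
  assumes "move c b k u v" and "descends n u" and "descends n v" and "set u \<subseteq> {1..<n}" and "1 \<le> n"
  shows "move c b k (delete_wire n u) (delete_wire n v) \<and> cost_left c b n n v = cost_left c b n n u \<or>
     delete_wire n v = delete_wire n u \<and> cost_left c b n n v \<le> cost_left c b n n u + k"
proof -
  obtain x y s t i j where uv: "u = x @ s @ y" "v = x @ t @ y" and m: "move c b k s t"
    and st: "s = [i, j] \<and> t = [j, i] \<and> (i + 1 < j \<or> j + 1 < i) \<and> k = c \<or>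
      k = b \<and> (s = [j, j + 1, j] \<and> t = [j + 1, j, j + 1] \<or> s = [j + 1, j, j + 1] \<and> t = [j, j + 1, j])"
    using assms(1)
  proof (cases rule: moveE)
    case (commute x y i j)
    then show thesis
      using that[of x "[i, j]" y "[j, i]" i j] move_commute[of i j c b "[]" "[]"] by simp
  next
    \<comment> \<open>The letter \<open>i\<close> occurs only in the commutation alternative, so any
      value serves here.\<close>
    case (braid x y j)
    then show thesis
      using that[of x "[j, j + 1, j]" y "[j + 1, j, j + 1]" undefined j] move_braid[of c b "[]" j "[]"] by simp
  next
    case (braid' x y j)
    then show thesis
      using that[of x "[j + 1, j, j + 1]" y "[j, j + 1, j]" undefined j]
        move_sym[OF move_braid[of c b "[]" j "[]"]] by simp
  qed
  let ?p = "wire_end n x"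
  have "0 \<notin> set x" using assms(4) uv by auto
  then have "?p \<le> n" using wire_end_bounds assms(5) by blast
  moreover have "descends ?p s" "descends ?p t"
    using assms(2,3) uv by (auto simp: wire_append)
  ultimately have *: "wire_end ?p t = wire_end ?p s \<and>
    (move c b k (delete_wire ?p s) (delete_wire ?p t) \<and> cost_left c b n ?p t = cost_left c b n ?p s \<or>
     delete_wire ?p t = delete_wire ?p s \<and> cost_left c b n ?p t \<le> cost_left c b n ?p s + k)"
    using move_wire_segment[OF m st] by blast
  then show ?thesis
    unfolding uv using move_context by (auto simp: wire_append)
qed

section \<open>Pushing crossings through the staircase\<close>

lemma upt_split:
  assumes "q \<le> y" and "y + 1 < n"
  shows "rev [q..<n] = rev [y + 2..<n] @ [y + 1, y] @ rev [q..<y]"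
proof -
  have "[q..<n] = [q..<y] @ [y..<n]"
    using assms upt_add_eq_append[of q y "n - y"] by simp
  moreover have "[y..<n] = y # (y + 1) # [y + 2..<n]"
    using assms by (simp add: upt_conv_Cons)
  ultimately show ?thesis by simp
qed

text \<open>Going left, y + 1 commutes with the y - q letters below y, meets y + 1, y in a braid,
  and emerges as y, which commutes with the n - y - 2 letters above y + 1.\<close>

lemma pass_path:
  assumes "q \<le> y" and "y + 1 < n"
  shows "path c b (c * (n - q - 2) + b) (rev [q..<n] @ [y + 1]) (y # rev [q..<n])"
proof -
  let ?A = "rev [y + 2..<n]" and ?B = "rev [q..<y]"
  have "path c b (c * length ?B) (?B @ [y + 1]) ((y + 1) # ?B)"
    by (intro path_sym[OF commute_path]) auto
  from path_context[OF this, of "?A @ [y + 1, y]" "[]"]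
  have 1: "path c b (c * length ?B) (?A @ [y + 1, y] @ ?B @ [y + 1]) (?A @ [y + 1, y, y + 1] @ ?B)"
    by simp
  have 2: "path c b b (?A @ [y + 1, y, y + 1] @ ?B) (?A @ [y, y + 1, y] @ ?B)"
    by (rule move_path[OF move_sym[OF move_braid]])
  have "path c b (c * length ?A) (?A @ [y]) (y # ?A)"
    by (intro path_sym[OF commute_path]) auto
  from path_context[OF this, of "[]" "[y + 1, y] @ ?B"]
  have 3: "path c b (c * length ?A) (?A @ [y, y + 1, y] @ ?B) (y # ?A @ [y + 1, y] @ ?B)"
    by simp
  have cost: "c * length ?B + (b + c * length ?A) = c * (n - q - 2) + b"
  proof -
    have "length ?B + length ?A = n - q - 2" using assms by simp
    then show ?thesis by (metis add.assoc add.commute add_mult_distrib2)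
  qed
  from path_trans[OF path_trans[OF 3 2] 1] show ?thesis
    unfolding upt_split[OF assms] cost by simp
qed

text \<open>Induction from the right end: the word before the last letter is already sorted, so this
  letter has to pass only the staircase collected so far.\<close>

lemma to_left_path:
  assumes "descends n w" and "set w \<subseteq> {1..<n}" and "1 \<le> n"
  shows "path c b (cost_left c b n n w) w (delete_wire n w @ rev [wire_end n w..<n])"
  using assms
proof (induction w rule: rev_induct)
  case Nil
  then show ?case by (simp add: path_refl)
next
  case (snoc x w)
  let ?q = "wire_end n w" and ?d = "delete_wire n w"
  have x: "1 \<le> x" "x < n" "set w \<subseteq> {1..<n}" "descends n w" "descends ?q [x]"
    using snoc.prems by (auto simp: wire_append)
  have q: "1 \<le> ?q" "?q \<le> n"
    using wire_end_bounds[of w n] subsetD[OF x(3), of 0] snoc.prems(3) by auto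
  have "path c b (cost_left c b n n w) w (?d @ rev [?q..<n])"
    using snoc.IH x snoc.prems by blast
  from path_context[OF this, of "[]" "[x]"]
  have IH: "path c b (cost_left c b n n w) (w @ [x]) (?d @ rev [?q..<n] @ [x])" by simp
  have "x \<noteq> ?q" using x(5) by (auto split: if_splits)
  then consider "x + 1 = ?q" | "x + 1 < ?q" | "?q < x" by linarith
  then show ?case
  proof cases
    case 1
    then have "rev [x..<n] = rev [?q..<n] @ [x]" using x by (simp add: upt_conv_Cons)
    then show ?thesis using IH 1 by (simp add: wire_append)
  next
    case 2
    have "path c b (c * length (rev [?q..<n])) (rev [?q..<n] @ [x]) (x # rev [?q..<n])"
      using 2 by (intro path_sym[OF commute_path]) auto
    from path_trans[OF path_context[OF this, of ?d "[]", simplified] IH[simplified]]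
    show ?thesis using 2 by (simp add: wire_append)
  next
    case 3
    then have "path c b (c * (n - ?q - 2) + b) (rev [?q..<n] @ [x]) ((x - 1) # rev [?q..<n])"
      using pass_path[of ?q "x - 1" n] x by simp
    from path_trans[OF path_context[OF this, of ?d "[]", simplified] IH[simplified]]
    show ?thesis using 3 by (simp add: wire_append)
  qed
qed

lemma to_right_path:
  assumes "descends p w" and "set w \<subseteq> {1..}" and "1 \<le> p" and "wire_end p w = 1"
  shows "path c b (cost_right c b p w) w (rev [1..<p] @ map (\<lambda>x. x + 1) (delete_wire p w))"
  using assms
proof (induction w arbitrary: p)
  case Nil
  then show ?case by (simp add: path_refl)
next
  case (Cons x w)
  have x: "1 \<le> x" "set w \<subseteq> {1..}" using Cons.prems by auto
  have "x \<noteq> p" using Cons.prems by (auto split: if_splits)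
  then consider "x + 1 = p" | "x + 1 < p" | "p < x" by linarith
  then show ?case
  proof cases
    case 1
    have "path c b (cost_right c b x w) w (rev [1..<x] @ map (\<lambda>x. x + 1) (delete_wire x w))"
      using Cons.IH[of x] Cons.prems x 1 by auto
    from path_context[OF this, of "[x]" "[]"] show ?thesis
      using 1 x by auto
  next
    case 2
    let ?t = "map (\<lambda>x. x + 1) (delete_wire p w)"
    have "path c b (cost_right c b p w) w (rev [1..<p] @ ?t)"
      using Cons.IH[of p] Cons.prems x 2 by auto
    from path_context[OF this, of "[x]" "[]"]
    have IH: "path c b (cost_right c b p w) (x # w) (x # rev [1..<p] @ ?t)" by simp
    \<comment> \<open>This is \<open>pass_path\<close> backwards, with 1 and p as the ends of the
      staircase: the letter enters as x and leaves as x + 1.\<close>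
    have "path c b (c * (p - 3) + b) (x # rev [1..<p]) (rev [1..<p] @ [x + 1])"
      using path_sym[OF pass_path[of 1 x p c b]] 2 x by (simp add: numeral_eq_Suc)
    from path_context[OF this, of "[]" ?t]
    have "path c b (c * (p - 3) + b) (x # rev [1..<p] @ ?t) (rev [1..<p] @ (x + 1) # ?t)" by simp
    from path_trans[OF this IH] show ?thesis using 2 by (simp add: add.commute)
  next
    case 3
    let ?t = "map (\<lambda>x. x + 1) (delete_wire p w)"
    have "path c b (cost_right c b p w) w (rev [1..<p] @ ?t)"
      using Cons.IH[of p] Cons.prems x 3 by auto
    from path_context[OF this, of "[x]" "[]"]
    have IH: "path c b (cost_right c b p w) (x # w) (x # rev [1..<p] @ ?t)" by simp
    have "path c b (c * length (rev [1..<p])) (x # rev [1..<p]) (rev [1..<p] @ [x])"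
      using 3 by (intro commute_path) auto
    from path_context[OF this, of "[]" ?t]
    have "path c b (c * (p - 1)) (x # rev [1..<p] @ ?t) (rev [1..<p] @ x # ?t)" by simp
    from path_trans[OF this IH] show ?thesis using 3 by (simp add: add.commute)
  qed
qed

section \<open>Reduced words of a skew sum\<close>

lemma word_prod_staircase:
  assumes "q \<le> n"
  shows "word_prod (rev [q..<n]) x = (if x = q then n else if q < x \<and> x \<le> n then x - 1 else x)"
  using assms
proof (induction n rule: dec_induct)
  case (step n)
  then show ?case by (auto simp: word_prod_Cons simple_transp_simps)
qed auto

text \<open>The word \<open>u\<close> leaves the value n in position n, and the staircase carries it
  down past one smaller entry at a time.\<close>

lemma asc_staircase:
  assumes "asc u" and "set u \<subseteq> {1..<n - 1}" and "1 \<le> q" and "q \<le> n"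
  shows "asc (u @ rev [q..<n])"
  using assms(4,3)
proof (induction q rule: inc_induct)
  case base
  then show ?case using assms(1) by simp
next
  case (step q)
  let ?w = "u @ rev [Suc q..<n]"
  have "word_prod u q \<in> {1..n - 1}"
    using word_prod_mem[OF assms(2)] step by simp
  moreover have "word_prod u n = n"
    using assms(2) step by (intro word_prod_fixes) fastforce
  ultimately have "word_prod ?w q < word_prod ?w (q + 1)"
    using step by (auto simp: word_prod_append word_prod_staircase)
  moreover have "asc ?w" using step by simp
  ultimately have "asc (?w @ [q])" unfolding asc_snoc by blast
  then show ?case using step by (simp add: upt_conv_Cons)
qed

lemma length_reduced_word: "w \<in> reduced_words \<pi> \<Longrightarrow> length w = inv_count \<pi>"
  by (simp add: reduced_words_def)

lemma length_inflate21 [simp]: "length (inflate21 [1] \<sigma>) = length \<sigma> + 1"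
  by (simp add: inflate21_def)

lemma staircase_reduced_words_iff:
  assumes "set u \<subseteq> {1..length \<sigma> - 1}"
  shows "u @ rev [1..<length \<sigma> + 1] \<in> reduced_words (inflate21 [1] \<sigma>) \<longleftrightarrow> u \<in> reduced_words \<sigma>"
proof -
  let ?n = "length \<sigma> + 1"
  let ?w = "u @ rev [1..<?n]"
  have fix_n: "word_prod u ?n = ?n"
    using assms by (intro word_prod_fixes) fastforce
  have prod: "word_prod ?w x = word_prod u (if x = 1 then ?n else if 1 < x \<and> x \<le> ?n then x - 1 else x)" for x
    unfolding word_prod_append comp_apply by (subst word_prod_staircase) simp_all
  have "word_prod ?w (i + 1) = inflate21 [1] \<sigma> ! i \<longleftrightarrow> i = 0 \<or> word_prod u i = \<sigma> ! (i - 1)"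
    if "i < ?n" for i
    using that fix_n
    unfolding prod by (cases i) (auto simp: inflate21_def)
  then have "(\<forall>i<?n. word_prod ?w (i + 1) = inflate21 [1] \<sigma> ! i) \<longleftrightarrow>
      (\<forall>i<length \<sigma>. word_prod u (i + 1) = \<sigma> ! i)"
    by (auto simp: less_Suc_eq_0_disj)
  moreover have "asc ?w \<longleftrightarrow> asc u"
  proof -
    have "set u \<subseteq> {1..<?n - 1}" using assms by (auto simp: subset_iff)
    then show ?thesis
      using asc_appendD asc_staircase[OF _ _ order_refl le_add2] by blast
  qed
  moreover have "set ?w \<subseteq> {1..?n - 1}"
  proof -
    have "set u \<subseteq> {1..?n - 1}" using assms by (rule subset_trans) auto
    then show ?thesis by (simp del: upt_Suc) auto
  qed
  ultimately show ?thesis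
    unfolding reduced_words_iff length_inflate21 using assms by blast
qed

text \<open>The wire carries the largest value n. A letter equal to its position would exchange n
  with a smaller right neighbour, which is a descent.\<close>

lemma asc_descends:
  assumes "asc w" and "set w \<subseteq> {1..<n}" and "1 \<le> n"
  shows "descends n w \<and> word_prod w (wire_end n w) = n"
  using assms
proof (induction w rule: rev_induct)
  case (snoc x w)
  let ?q = "wire_end n w"
  have x: "1 \<le> x" "x < n" "set w \<subseteq> {1..<n}" using snoc.prems by auto
  have asc: "asc w" "word_prod w x < word_prod w (x + 1)" using snoc.prems by (simp_all add: asc_snoc)
  have IH: "descends n w" "word_prod w ?q = n"
    using snoc.IH[OF asc(1) x(3) snoc.prems(3)] by simp_all
  have "word_prod w (x + 1) \<le> n"
    using word_prod_mem[OF x(3), of "x + 1"] x by simp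
  then have "x \<noteq> ?q" using asc(2) IH(2) by auto
  then show ?case
    using IH by (auto simp: wire_append word_prod_snoc simple_transp_simps)
qed simp

lemma set_delete_wire:
  assumes "set w \<subseteq> {1..<n}" and "descends p w" and "1 \<le> p" and "p \<le> n"
  shows "set (delete_wire p w) \<subseteq> {1..n - 2}"
  using assms
proof (induction w arbitrary: p)
  case (Cons x w)
  have x: "1 \<le> x" "x < n" "set w \<subseteq> {1..<n}" using Cons.prems by auto
  show ?case
  proof (cases "x + 1 = p")
    case True
    then show ?thesis using Cons.IH[of x] Cons.prems x by simp
  next
    case False
    then have "x \<noteq> p" "set (delete_wire p w) \<subseteq> {1..n - 2}"
      using Cons.IH[of p] Cons.prems x by simp_all
    moreover have "(if x < p then x else x - 1) \<in> {1..n - 2}"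
      using False \<open>x \<noteq> p\<close> x Cons.prems(3,4) by auto
    ultimately show ?thesis using False by (simp only: delete_wire.simps if_False set_simps insert_subset)
  qed
qed simp

lemma wire_low:
  assumes "set u \<subseteq> {1..<n - 1}"
  shows "wire_end n u = n" "delete_wire n u = u" "cost_left c b n n u = 0"
  using assms by (induction u) auto

lemma wire_staircase:
  assumes "q \<le> n"
  shows "wire_end n (rev [q..<n]) = q" "delete_wire n (rev [q..<n]) = []"
    "cost_left c b m n (rev [q..<n]) = 0"
  using assms by (induction n rule: dec_induct) auto

lemma delete_wire_bounds:
  assumes "1 \<le> n"
  shows "set u \<subseteq> {1..<n - 1} \<Longrightarrow>
      delete_wire n (u @ rev [1..<n]) = u \<and> cost_left c b n n (u @ rev [1..<n]) = 0"
    and "set u \<subseteq> {1..} \<Longrightarrow>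
      delete_wire n (rev [1..<n] @ map (\<lambda>x. x + 1) u) = u \<and>
      cost_right c b n (rev [1..<n] @ map (\<lambda>x. x + 1) u) = 0"
proof -
  show "delete_wire n (u @ rev [1..<n]) = u \<and> cost_left c b n n (u @ rev [1..<n]) = 0"
    if "set u \<subseteq> {1..<n - 1}"
    using assms by (simp add: wire_append wire_low[OF that] wire_staircase)
  assume u: "set u \<subseteq> {1..}"
  have "delete_wire 1 (map (\<lambda>x. x + 1) u) = u"
    using u by (induction u) auto
  moreover have "cost_right c b 1 (map (\<lambda>x. x + 1) u) = 0"
    using u by (induction u) auto
  moreover have "cost_right c b n (rev [1..<n] @ v) = cost_right c b 1 v" for v
    using assms by (induction n rule: dec_induct) auto
  ultimately show "delete_wire n (rev [1..<n] @ map (\<lambda>x. x + 1) u) = u \<and>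
      cost_right c b n (rev [1..<n] @ map (\<lambda>x. x + 1) u) = 0"
    using assms by (simp add: wire_append wire_staircase)
qed

lemma has_diam_inflate21:
  assumes \<sigma>: "has_diam c b (reduced_words \<sigma>) D"
  shows "has_diam c b (reduced_words (inflate21 [1] \<sigma>)) (D + inv_count \<sigma> * (c * (length \<sigma> - 2) + b))"
proof -
  let ?n = "length \<sigma> + 1"
  let ?X = "reduced_words (inflate21 [1] \<sigma>)"
  let ?\<delta> = "rev [1..<?n]"
  let ?F = "cost_left c b ?n ?n" and ?F' = "cost_right c b ?n"
  have X: "asc w" "set w \<subseteq> {1..<?n}" "word_prod w 1 = ?n" if "w \<in> ?X" for w
    using that by (auto simp: reduced_words_iff inflate21_def)
  have desc: "descends ?n w" "wire_end ?n w = 1" if "w \<in> ?X" for w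
  proof -
    have *: "descends ?n w \<and> word_prod w (wire_end ?n w) = ?n"
      using asc_descends[OF X(1,2)[OF that]] by simp
    then show "descends ?n w" ..
    have "word_prod w (wire_end ?n w) = word_prod w 1"
      using * X(3)[OF that] by simp
    then show "wire_end ?n w = 1"
      using inj_word_prod[of w] by (simp only: inj_eq)
  qed
  have low: "set u \<subseteq> {1..length \<sigma> - 1}" "set u \<subseteq> {1..<?n - 1}" if "u \<in> reduced_words \<sigma>" for u
    using that by (auto simp: reduced_words_iff subset_iff)
  have to_lo: "path c b (?F w) w (delete_wire ?n w @ ?\<delta>)" if "w \<in> ?X" for w
    using to_left_path[OF desc(1)[OF that] X(2)[OF that]] unfolding desc(2)[OF that] by simp
  have to_hi: "path c b (?F' w) w (?\<delta> @ map (\<lambda>x. x + 1) (delete_wire ?n w))" if "w \<in> ?X" for w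
    using X(2)[OF that] by (intro to_right_path desc that) auto
  have del: "delete_wire ?n w \<in> reduced_words \<sigma>" if w: "w \<in> ?X" for w
  proof -
    have "set (delete_wire ?n w) \<subseteq> {1..length \<sigma> - 1}"
      using set_delete_wire[OF X(2)[OF w] desc(1)[OF w]] by simp
    then show ?thesis
      using staircase_reduced_words_iff reduced_words_path[OF to_lo[OF w] w] by blast
  qed
  have sum: "?F w + ?F' w = inv_count \<sigma> * (c * (length \<sigma> - 2) + b)" if "w \<in> ?X" for w
    using cost_sum[OF X(2)[OF that] desc(1)[OF that], of c b] del[OF that]
    by (simp add: reduced_words_def numeral_eq_Suc)
  have lo: "u @ ?\<delta> \<in> ?X \<and> delete_wire ?n (u @ ?\<delta>) = u \<and> ?F (u @ ?\<delta>) = 0"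
    if u: "u \<in> reduced_words \<sigma>" for u
  proof -
    have "u @ ?\<delta> \<in> ?X"
      using staircase_reduced_words_iff[OF low(1)[OF u]] u by blast
    moreover have "delete_wire ?n (u @ ?\<delta>) = u" "?F (u @ ?\<delta>) = 0"
      using delete_wire_bounds(1)[OF _ low(2)[OF u]] by (metis le_add2)+
    ultimately show ?thesis by blast
  qed
  have hi: "?\<delta> @ map (\<lambda>x. x + 1) u \<in> ?X \<and> delete_wire ?n (?\<delta> @ map (\<lambda>x. x + 1) u) = u \<and>
      ?F (?\<delta> @ map (\<lambda>x. x + 1) u) = inv_count \<sigma> * (c * (length \<sigma> - 2) + b)"
    if u: "u \<in> reduced_words \<sigma>" for u
  proof -
    let ?w = "?\<delta> @ map (\<lambda>x. x + 1) u"
    have X': "?w \<in> ?X"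
      using reduced_words_path[OF to_hi[of "u @ ?\<delta>"]] lo[OF u] by simp
    have "set u \<subseteq> {1..}" using low(1)[OF u] by auto
    then have "delete_wire ?n ?w = u" "?F' ?w = 0"
      using delete_wire_bounds(2)[of ?n u] by (metis le_add2)+
    \<comment> \<open>The value of \<open>?F\<close> follows from \<open>sum\<close>, since the
      complementary cost \<open>?F'\<close> vanishes.\<close>
    then show ?thesis using X' sum[OF X'] by simp
  qed
  have "has_diam c b ?X (D + 0 + inv_count \<sigma> * (c * (length \<sigma> - 2) + b))"
  \<comment> \<open>The second base is a single point. Its word is still appended in
    \<open>lo\<close> and \<open>hi\<close>, because their path conditions ask for cost exactly i +
    j for arbitrary second arguments.\<close>
  proof (rule has_diam_fibration[OF \<sigma> has_diam_singleton[of c b "[]"], where X = ?X and F = ?F and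
        F' = ?F' and \<phi> = "delete_wire ?n" and \<psi> = "\<lambda>_. []" and
        lo = "\<lambda>u v. u @ ?\<delta> @ v" and hi = "\<lambda>u v. ?\<delta> @ map (\<lambda>x. x + 1) u @ v"])
    show "v \<in> ?X" if "u \<in> ?X" "move c b k u v" for k u v
      using reduced_words_move that .
    show "move c b k (delete_wire ?n u) (delete_wire ?n v) \<and> [] = [] \<and> ?F v = ?F u \<or>
        delete_wire ?n v = delete_wire ?n u \<and> move c b k [] [] \<and> ?F v = ?F u \<or>
        delete_wire ?n v = delete_wire ?n u \<and> [] = [] \<and> ?F v \<le> ?F u + k"
      if "u \<in> ?X" "move c b k u v" for k u v
      using move_delete_wire[OF that(2) desc(1)[OF that(1)] desc(1) X(2)[OF that(1)]]
        reduced_words_move[OF that] by auto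
    show "path c b (i + j) (y @ ?\<delta> @ z) (y' @ ?\<delta> @ z')"
      if "path c b i y y'" "path c b j z z'" for i j y y' z z'
      using path_append[OF that(1) path_context[OF that(2), of ?\<delta> "[]"]] by simp
    show "path c b (i + j) (?\<delta> @ map (\<lambda>x. x + 1) y @ z) (?\<delta> @ map (\<lambda>x. x + 1) y' @ z')"
      if "path c b i y y'" "path c b j z z'" for i j y y' z z'
      using path_context[OF path_append[OF path_map[OF that(1), of 1] that(2)], of ?\<delta> "[]"] by simp
  qed (use del lo hi to_lo to_hi sum in auto)
  then show ?thesis by simp
qed

section \<open>Decomposition of 231-avoiding permutations\<close>

lemma contains_pattern_subseq: "subseq xs ys \<Longrightarrow> contains_pattern xs \<sigma> \<Longrightarrow> contains_pattern ys \<sigma>"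
  unfolding contains_pattern_def using subseq_order.trans by blast

lemma contains_pattern_map_add:
  assumes "contains_pattern xs \<sigma>"
  shows "contains_pattern (map (\<lambda>x. x + a) xs) \<sigma>"
proof -
  obtain zs where "subseq zs xs" "order_isomorphic zs \<sigma>"
    using assms unfolding contains_pattern_def by blast
  then have "subseq (map (\<lambda>x. x + a) zs) (map (\<lambda>x. x + a) xs)"
    "order_isomorphic (map (\<lambda>x. x + a) zs) \<sigma>"
    by (simp_all add: subseq_map order_isomorphic_def)
  then show ?thesis unfolding contains_pattern_def by blast
qed

lemma avoids_231_separated:
  assumes "avoids (xs @ z # ys) [2, 3, 1]" and "distinct (xs @ ys)"
    and "x \<in> set xs" and "y \<in> set ys" and "x < z"
  shows "x < y"
proof (rule ccontr)
  assume "\<not> x < y"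
  moreover have "x \<noteq> y" using assms(2-4) by auto
  ultimately have "y < x" by simp
  have "subseq ([x] @ [z] @ [y]) (xs @ [z] @ ys)"
    using assms(3,4) by (intro list_emb_append_mono) (simp_all add: subseq_singleton_left)
  moreover have "order_isomorphic [x, z, y] [2, 3, 1]"
    using \<open>y < x\<close> assms(5) by (auto simp: order_isomorphic_def less_Suc_eq)
  ultimately show False
    using assms(1) unfolding avoids_def contains_pattern_def by auto
qed

lemma downward_closed_eq:
  fixes A :: "nat set"
  assumes "finite A" and "\<And>x. x \<in> A \<Longrightarrow> {1..x} \<subseteq> A" and "0 \<notin> A"
  shows "A = {1..card A}"
proof (cases "A = {}")
  case False
  have "A \<subseteq> {1..Max A}"
    using assms(1,3) by (auto simp: Suc_le_eq intro!: gr0I)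
  moreover have "{1..Max A} \<subseteq> A" using assms(2) Max_in[OF assms(1) False] .
  ultimately have A: "A = {1..Max A}" ..
  have "card A = Max A" by (subst A) simp
  then show ?thesis using A by simp
qed simp

lemma length_permutation: "\<pi> \<in> permutations_of_set {1..n} \<Longrightarrow> length \<pi> = n"
  using distinct_card[of \<pi>] permutations_of_setD[of \<pi> "{1..n}"] by simp

lemma avoids_231_decomposition:
  assumes "\<pi> \<in> permutations_of_set {1..n}" and "avoids \<pi> [2, 3, 1]"
    and "m \<in> {1..n}" and "\<pi> ! (m - 1) = n"
  obtains \<pi>' \<pi>'' where "\<pi>' \<in> permutations_of_set {1..m - 1}" "avoids \<pi>' [2, 3, 1]"
    "\<pi>'' \<in> permutations_of_set {1..n - m}" "avoids \<pi>'' [2, 3, 1]"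
    "\<pi> = inflate12 \<pi>' (inflate21 [1] \<pi>'')"
proof -
  let ?xs = "take (m - 1) \<pi>" and ?ys = "drop m \<pi>"
  let ?\<pi>'' = "map (\<lambda>y. y - (m - 1)) ?ys"
  have set_\<pi>: "set \<pi> = {1..n}" and dist: "distinct \<pi>"
    using assms(1) by (auto dest: permutations_of_setD)
  have len: "length \<pi> = n" using length_permutation[OF assms(1)] .
  have \<pi>: "\<pi> = ?xs @ n # ?ys"
  proof -
    have "m - 1 < length \<pi>" "Suc (m - 1) = m" using assms(3) len by auto
    then show ?thesis using id_take_nth_drop[of "m - 1" \<pi>] assms(4) by simp
  qed
  have dist': "distinct (?xs @ n # ?ys)" using dist \<pi> by simp
  have "set (?xs @ n # ?ys) = {1..n}" using set_\<pi> \<pi> by simp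
  then have un: "set ?xs \<union> set ?ys = {1..n} - {n}" using dist' by auto
  have sep: "x < y" if "x \<in> set ?xs" "y \<in> set ?ys" for x y
  proof -
    have "x \<in> {1..n} - {n}" using un that(1) by blast
    then have "x < n" by auto
    moreover have "avoids (?xs @ n # ?ys) [2, 3, 1]" using assms(2) \<pi> by simp
    ultimately show ?thesis using avoids_231_separated that dist' by auto
  qed
  \<comment> \<open>By \<open>sep\<close> a value below an entry left of n cannot stand right of n,
    so the left entries form an initial segment.\<close>
  have "set ?xs = {1..card (set ?xs)}"
  proof (rule downward_closed_eq)
    fix x assume x: "x \<in> set ?xs"
    show "{1..x} \<subseteq> set ?xs"
    proof
      fix y assume "y \<in> {1..x}"
      moreover have "x \<in> {1..n} - {n}" using x un by blast
      ultimately have "y \<in> set ?xs \<union> set ?ys" unfolding un by auto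
      then show "y \<in> set ?xs" using sep[OF x, of y] \<open>y \<in> {1..x}\<close> by auto
    qed
  next
    have "set ?xs \<subseteq> {1..n}" using un by auto
    then show "0 \<notin> set ?xs" by auto
  qed simp
  moreover have "card (set ?xs) = m - 1"
    using dist' distinct_card[of ?xs] assms(3) len by auto
  ultimately have xs: "set ?xs = {1..m - 1}" by simp
  have "set ?ys = ({1..n} - {n}) - {1..m - 1}"
    using un dist' unfolding xs[symmetric] by auto
  moreover have "({1..n} - {n}) - {1..m - 1} = {m..n - 1}"
    using assms(3) by (intro set_eqI) (simp; linarith)
  ultimately have ys: "set ?ys = {m..n - 1}" by (rule trans)
  have ys_eq: "map (\<lambda>x. x + (m - 1)) ?\<pi>'' = ?ys"
  proof -
    have "y - (m - 1) + (m - 1) = y" if "y \<in> set ?ys" for y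
      using that unfolding ys by auto
    then show ?thesis by (simp add: map_idI)
  qed
  have "set ?\<pi>'' = {1..n - m}"
  proof -
    have "set ?\<pi>'' = (\<lambda>y. y - (m - 1)) ` {m..n - 1}" by (simp add: ys)
    also have "\<dots> = {1..n - m}"
    proof (intro equalityI subsetI)
      fix y assume "y \<in> {1..n - m}"
      then show "y \<in> (\<lambda>y. y - (m - 1)) ` {m..n - 1}"
        using assms(3) by (intro image_eqI[of _ _ "y + (m - 1)"]) auto
    qed (use assms(3) in auto)
    finally show ?thesis .
  qed
  moreover have "distinct ?\<pi>''"
    using dist' by (subst (asm) ys_eq[symmetric]) (simp add: distinct_map del: map_map)
  ultimately have 1: "?\<pi>'' \<in> permutations_of_set {1..n - m}" by auto
  have 2: "?xs \<in> permutations_of_set {1..m - 1}" using xs dist' by auto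
  have sub: "subseq ?xs \<pi>" "subseq ?ys \<pi>"
    using prefix_imp_subseq[OF take_is_prefix] suffix_imp_subseq[OF suffix_drop] by blast+
  have 3: "avoids ?xs [2, 3, 1]"
    using sub(1) assms(2) contains_pattern_subseq unfolding avoids_def by blast
  have 4: "avoids ?\<pi>'' [2, 3, 1]"
    using sub(2) assms(2) contains_pattern_subseq contains_pattern_map_add[of ?\<pi>'' _ "m - 1"]
    unfolding avoids_def ys_eq by blast
  have "length ?xs = m - 1" "length ?\<pi>'' = n - m" using assms(3) len by auto
  \<comment> \<open>The single point becomes 1 + (n - m) in the skew sum and n after the shift by m
    - 1.\<close>
  then have "inflate12 ?xs (inflate21 [1] ?\<pi>'') = ?xs @ n # ?ys"
    using assms(3) ys_eq by (simp add: inflate12_def inflate21_def del: map_map)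
  then have "\<pi> = inflate12 ?xs (inflate21 [1] ?\<pi>'')" using \<pi> by simp
  then show thesis using that 1 2 3 4 by blast
qed

section \<open>Assembling the recursion\<close>

lemma has_diam_231_step:
  assumes "\<pi>' \<in> permutations_of_set {1..k}"
    and \<pi>': "has_diam c b (reduced_words \<pi>') D'" and \<pi>'': "has_diam c b (reduced_words \<pi>'') D''"
  shows "has_diam c b (reduced_words (inflate12 \<pi>' (inflate21 [1] \<pi>'')))
    (D' + (D'' + inv_count \<pi>'' * (c * (length \<pi>'' - 2) + b)) +
     c * (inv_count \<pi>' * (length \<pi>'' + inv_count \<pi>'')))"
proof -
  \<comment> \<open>The inversion number of 21[1, \<pi>''] is read off as the length of one explicit
    reduced word.\<close>
  obtain u where u: "u \<in> reduced_words \<pi>''" using has_diam_far[OF \<pi>''] by blast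
  then have "set u \<subseteq> {1..length \<pi>'' - 1}" by (simp add: reduced_words_def)
  then have "u @ rev [1..<length \<pi>'' + 1] \<in> reduced_words (inflate21 [1] \<pi>'')"
    using staircase_reduced_words_iff u by blast
  from length_reduced_word[OF this] have "inv_count (inflate21 [1] \<pi>'') = length \<pi>'' + inv_count \<pi>''"
    using length_reduced_word[OF u] by (simp del: upt_Suc)
  then show ?thesis
    using has_diam_inflate12[OF _ \<pi>' has_diam_inflate21[OF \<pi>'']] length_permutation assms(1) by metis
qed

lemma ex_has_diam_231:
  assumes "\<pi> \<in> permutations_of_set {1..n}" and "avoids \<pi> [2, 3, 1]"
  shows "\<exists>D. has_diam c b (reduced_words \<pi>) D"
  using assms
proof (induction n arbitrary: \<pi> rule: less_induct)
  case (less n)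
  show ?case
  proof (cases "n = 0")
    case True
    then have "\<pi> = []" using less.prems(1) by (auto dest: permutations_of_setD)
    then have "reduced_words \<pi> = {[]}" by (auto simp: reduced_words_iff)
    then show ?thesis using has_diam_singleton[of c b "[]"] by metis
  next
    case False
    then have "n \<in> set \<pi>" using less.prems(1) by (auto dest: permutations_of_setD)
    then obtain i where "i < n" "\<pi> ! i = n"
      using length_permutation[OF less.prems(1)] by (auto simp: in_set_conv_nth)
    then have m: "Suc i \<in> {1..n}" "\<pi> ! (Suc i - 1) = n" by auto
    from avoids_231_decomposition[OF less.prems m] obtain \<pi>' \<pi>'' where
      *: "\<pi>' \<in> permutations_of_set {1..Suc i - 1}" "avoids \<pi>' [2, 3, 1]"
      "\<pi>'' \<in> permutations_of_set {1..n - Suc i}" "avoids \<pi>'' [2, 3, 1]"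
      "\<pi> = inflate12 \<pi>' (inflate21 [1] \<pi>'')" .
    obtain D' D'' where "has_diam c b (reduced_words \<pi>') D'" "has_diam c b (reduced_words \<pi>'') D''"
      using less.IH[OF _ *(1,2)] less.IH[OF _ *(3,4)] m(1) False by auto
    from has_diam_231_step[OF *(1) this] show ?thesis using *(5) by auto
  qed
qed

text \<open>Reconciles the truncated \<open>length \<pi>'' - 2\<close> with the real n - m - 2: they
  differ only for sizes 0 and 1, where the factor \<ell>(\<pi>'') vanishes.\<close>

lemma inv_count_small:
  assumes "u \<in> reduced_words \<pi>" and "length \<pi> < 2"
  shows "inv_count \<pi> = 0"
proof -
  have "set u = {}" "length u = inv_count \<pi>"
    using assms by (auto simp: reduced_words_def)
  then show ?thesis by simp
qed

theorem theorem5p5: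
  fixes \<pi> :: "nat list" and n m :: nat
  assumes "\<pi> \<in> permutations_of_set {1..n}"
    and "avoids \<pi> [2, 3, 1]"
    and "m \<in> {1..n}"
    and "\<pi> ! (m - 1) = n"
  shows "\<exists>\<pi>' \<pi>''.
    \<pi>' \<in> permutations_of_set {1..m - 1} \<and> avoids \<pi>' [2, 3, 1] \<and>
    \<pi>'' \<in> permutations_of_set {1..n - m} \<and> avoids \<pi>'' [2, 3, 1] \<and>
    \<pi> = inflate12 \<pi>' (inflate21 [1] \<pi>'') \<and>
    diam (G_graph \<pi>) = diam (G_graph \<pi>') + diam (G_graph \<pi>'')
      + ereal ((real n - real m) * (real (inv_count \<pi>') + real (inv_count \<pi>''))
               + real (inv_count \<pi>'') * (real (inv_count \<pi>') - 1)) \<and>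
    diam (C_graph \<pi>) = diam (C_graph \<pi>') + diam (C_graph \<pi>'')
      + ereal (real (inv_count \<pi>'')) \<and>
    diam (B_graph \<pi>) = diam (B_graph \<pi>') + diam (B_graph \<pi>'')
      + ereal ((real n - real m) * (real (inv_count \<pi>') + real (inv_count \<pi>''))
               + real (inv_count \<pi>'') * (real (inv_count \<pi>') - 2))"
proof -
  obtain \<pi>' \<pi>'' where \<pi>': "\<pi>' \<in> permutations_of_set {1..m - 1}" "avoids \<pi>' [2, 3, 1]"
    and \<pi>'': "\<pi>'' \<in> permutations_of_set {1..n - m}" "avoids \<pi>'' [2, 3, 1]"
    and \<pi>: "\<pi> = inflate12 \<pi>' (inflate21 [1] \<pi>'')"
    using avoids_231_decomposition[OF assms] .
  let ?l' = "real (inv_count \<pi>')" and ?l'' = "real (inv_count \<pi>'')"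
  have len: "length \<pi>'' = n - m" using length_permutation \<pi>''(1) .
  have k: "real (length \<pi>'') = real n - real m" using assms(3) len by (simp add: of_nat_diff)
  have diams: "\<exists>D D' D''. has_diam c b (reduced_words \<pi>) D \<and> has_diam c b (reduced_words \<pi>') D' \<and>
      has_diam c b (reduced_words \<pi>'') D'' \<and>
      real D = real D' + real D'' + ?l'' * (real c * (real n - real m - 2) + real b) +
        real c * (?l' * (real n - real m + ?l''))" for c b
  proof -
    obtain D' where D': "has_diam c b (reduced_words \<pi>') D'" using ex_has_diam_231[OF \<pi>'] by blast
    obtain D'' where D'': "has_diam c b (reduced_words \<pi>'') D''" using ex_has_diam_231[OF \<pi>''] by blast
    obtain u where u: "u \<in> reduced_words \<pi>''" using has_diam_far[OF D''] by blast
    have "?l'' * real (length \<pi>'' - 2) = ?l'' * (real n - real m - 2)"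
      using inv_count_small[OF u] k by (cases "length \<pi>'' < 2") (auto simp: of_nat_diff)
    then have "?l'' * (real c * real (length \<pi>'' - 2) + real b) =
        ?l'' * (real c * (real n - real m - 2) + real b)"
      by (simp add: distrib_left mult.left_commute)
    then show ?thesis
      using has_diam_231_step[OF \<pi>'(1) D' D''] D' D'' \<pi> k by fastforce
  qed
  have G: "diam (G_graph \<pi>) = diam (G_graph \<pi>') + diam (G_graph \<pi>'')
      + ereal ((real n - real m) * (?l' + ?l'') + ?l'' * (?l' - 1))"
    using diams[of 1 1] by (auto simp: diam_G_graph algebra_simps)
  have C: "diam (C_graph \<pi>) = diam (C_graph \<pi>') + diam (C_graph \<pi>'') + ereal ?l''"
    using diams[of 0 1] by (auto simp: diam_C_graph)
  have B: "diam (B_graph \<pi>) = diam (B_graph \<pi>') + diam (B_graph \<pi>'')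
      + ereal ((real n - real m) * (?l' + ?l'') + ?l'' * (?l' - 2))"
    using diams[of 1 0] by (auto simp: diam_B_graph algebra_simps)
  show ?thesis
    using \<pi>' \<pi>'' \<pi> G C B by blast
qed

end
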